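(* The algorithm $\mathrm{ALG}_{\mathrm{seq}}$ for QRAP-NC specified in the context (main routine together with its procedures SolveSubproblems, LowerSubproblem and UpperSubproblem) can be implemented such that its worst-case time complexity is $O(n \log n)$.
   Context: For $a \in \mathbb{R}^n_{>0}$, $L,U \in \mathbb{R}^{n-1}$, $R \in \mathbb{R}$, $l,u \in \mathbb{R}^n$, the quadratic resource allocation problem with nested constraints (QRAP-NC) is $$\min_{x \in \mathbb{R}^n} \ \sum_{i=1}^n \frac{1}{2}\frac{x_i^2}{a_i} \quad \text{s.t.} \quad L_j \leq \sum_{i=1}^j x_i \leq U_j \ (j = 1,\ldots,n-1), \quad \sum_{i=1}^n x_i = R, \quad l_i \leq x_i \leq u_i \ (i=1,\ldots,n).$$ Set $L_n = U_n = R$; it is assumed that $L_j < U_j$ for $j \le n-1$. All variables below are shared between the main routine and the procedures. $\mathcal{A},\mathcal{B},\mathcal{K},\mathcal{L}$ are sets of real numbers ("breakpoints"); each element carries its identity as some $\alpha_k^k$ (in $\mathcal{A}$), $\beta_k^k$ (in $\mathcal{B}$), $\kappa^k$ (in $\mathcal{K}$) or $\lambda^k$ (in $\mathcal{L}$). "Return" inside a procedure ends that procedure. **Main routine $\mathrm{ALG}_{\mathrm{seq}}$.** Input: $a, L, U, R, l, u$. Output: optimal solution to QRAP-NC. 1. $L_1 := \max(L_1,l_1)$; $U_1 := \min(U_1,u_1)$. For $j=2,\ldots,n$: $L_j := \max(L_j, L_{j-1}+l_j)$; $U_j := \min(U_j, U_{j-1}+u_j)$. 2. For $i=1,\ldots,n$: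 $\alpha_i^i := l_i/a_i$; $\beta_i^i := u_i/a_i$. 3. $\kappa^1 := \alpha_1^1$; $\lambda^1 := \beta_1^1$; $\kappa^j := \infty$ and $\lambda^j := -\infty$ for $j>1$. 4. $\mathcal{A} := \{\alpha_1^1\}$; $\mathcal{B} := \{\beta_1^1\}$; $\mathcal{K} := \emptyset$; $\mathcal{L} := \emptyset$; $\bar P^1_L = \bar P^1_U := 0$; $\bar Q^1_L = \bar Q^1_U := a_1$. 5. For $j=2,\ldots,n$: apply SolveSubproblems($j$). 6. $\chi^n := \kappa^n$. For $i=n-1$ down to $1$: $\chi^i := \kappa^i$ if $\chi^{i+1} \le \kappa^i$; $\chi^i := \lambda^i$ if $\chi^{i+1} \ge \lambda^i$; $\chi^i := \chi^{i+1}$ otherwise. 7. For each $i$: $x_i^n(R) := l_i$ if $\chi^i < \alpha_i^i$; $x_i^n(R) := a_i\chi^i$ if $\alpha_i^i \le \chi^i < \beta_i^i$; $x_i^n(R) := u_i$ if $\beta_i^i \le \chi^i$. Return $\bar x := x^n(R)$. **Procedure SolveSubproblems($j$).** (a) Let $s := L_{j-1} + \max(l_j, \min(a_j\kappa^{j-1},u_j))$. - If $s = L_j$: $\kappa^j := \kappa^{j-1}$; replace $\kappa^{j-1}$ in $\mathcal{K}$ by $\kappa^j$; and: if $\kappa^j < \alpha_j^j$, then $\bar P^j_L := \bar P^{j-1}_L + l_j$, $\bar Q^j_L := \bar Q^{j-1}_L$; else if $\beta_j^j < \kappa^j$, then $\bar P^j_L := \bar P^{j-1}_L + u_j$, $\bar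 Q^j_L := \bar Q^{j-1}_L$; else $\bar P^j_L := \bar P^{j-1}_L$, $\bar Q^j_L := \bar Q^{j-1}_L + a_j$. - Else if $s > L_j$: $\kappa^j := (L_j - L_{j-1})/a_j$; $\bar P^j_L := L_{j-1}$; $\bar Q^j_L := a_j$; add $\kappa^j$ to $\mathcal{K}$. - Else: remove $\kappa^{j-1}$ from $\mathcal{K}$. (b) Let $t := U_{j-1} + \max(l_j, \min(a_j\lambda^{j-1},u_j))$. - If $t = U_j$: $\lambda^j := \lambda^{j-1}$; replace $\lambda^{j-1}$ in $\mathcal{L}$ by $\lambda^j$; and: if $\lambda^j < \alpha_j^j$, then $\bar P^j_U := \bar P^{j-1}_U + l_j$, $\bar Q^j_U := \bar Q^{j-1}_U$; else if $\beta_j^j < \lambda^j$, then $\bar P^j_U := \bar P^{j-1}_U + u_j$, $\bar Q^j_U := \bar Q^{j-1}_U$; else $\bar P^j_U := \bar P^{j-1}_U$, $\bar Q^j_U := \bar Q^{j-1}_U + a_j$. - Else if $t < U_j$: $\lambda^j := (U_j - U_{j-1})/a_j$; $\bar P^j_U := U_{j-1}$; $\bar Q^j_U := a_j$; add $\lambda^j$ to $\mathcal{L}$. - Else: remove $\lambda^{j-1}$ from $\mathcal{L}$. (c) If $\min(\kappa^{j-1},\kappa^j) < \alpha_j^j \le \max(\lambda^{j-1},\lambda^j)$, add $\alpha_j^j$ to $\mathcal{A}$. If $\min(\kappa^{j-1},\kappa^j) \le \beta_j^j < \max(\lambda^{j-1},\lambda^j)$, add $\beta_j^j$ to $\mathcal{B}$.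 (d) If $\kappa^j > \lambda^{j-1}$: set $P := \bar P^{j-1}_L + l_j$, $Q := \bar Q^{j-1}_L$ if $\kappa^{j-1} < \alpha_j^j$; $P := \bar P^{j-1}_L$, $Q := \bar Q^{j-1}_L + a_j$ if $\alpha_j^j \le \kappa^{j-1} < \beta_j^j$; $P := \bar P^{j-1}_L + u_j$, $Q := \bar Q^{j-1}_L$ otherwise. Then apply LowerSubproblem($j$). (e) If $\lambda^j < \lambda^{j-1}$: set $P := \bar P^{j-1}_U + u_j$, $Q := \bar Q^{j-1}_U$ if $\beta_j^j < \lambda^{j-1}$; $P := \bar P^{j-1}_U$, $Q := \bar Q^{j-1}_U + a_j$ if $\alpha_j^j < \lambda^{j-1} \le \beta_j^j$; $P := \bar P^{j-1}_U + l_j$, $Q := \bar Q^{j-1}_U$ otherwise. Then apply UpperSubproblem($j$). **Procedure LowerSubproblem($j$).** Repeat until $\kappa^j$ has been determined: let $\delta$ be the minimum of all breakpoints in $\mathcal{A},\mathcal{B},\mathcal{K},\mathcal{L}$ and $\mathcal{D}\in\{\mathcal{A},\mathcal{B},\mathcal{K},\mathcal{L}\}$ the set it belongs to. - If $P+Q\delta = L_j$: $\kappa^j := \delta$; add $\kappa^j$ to $\mathcal{K}$; $\bar P^j_L := P$, $\bar Q^j_L := Q$; return. - Else if $P+Q\delta > L_j$: $\kappa^j := (L_j-P)/Q$; add $\kappa^j$ to $\mathcal{K}$; $\bar P^j_L := P$, $\bar Q^j_L := Q$; return. - Else: if $\mathcal{D}=\mathcal{A}$, $\delta=\alpha_k^k$: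 $P := P-l_k$, $Q := Q+a_k$, remove $\alpha_k^k$ from $\mathcal{A}$. If $\mathcal{D}=\mathcal{B}$, $\delta=\beta_k^k$: $P := P+u_k$, $Q := Q-a_k$, remove $\beta_k^k$ from $\mathcal{B}$. If $\mathcal{D}=\mathcal{K}$, $\delta=\kappa^k$: $P := P-\bar Q^k_L\kappa^k$, $Q := Q+\bar Q^k_L$, remove $\kappa^k$ from $\mathcal{K}$. If $\mathcal{D}=\mathcal{L}$, $\delta=\lambda^k$: $P := P+\bar Q^k_U\lambda^k$, $Q := Q-\bar Q^k_U$, remove $\lambda^k$ from $\mathcal{L}$. **Procedure UpperSubproblem($j$).** Repeat until $\lambda^j$ has been determined: let $\delta$ be the maximum of all breakpoints in $\mathcal{A},\mathcal{B},\mathcal{K},\mathcal{L}$ and $\mathcal{D}$ the set it belongs to. - If $P+Q\delta = U_j$: $\lambda^j := \delta$; add $\lambda^j$ to $\mathcal{L}$; $\bar P^j_U := P$, $\bar Q^j_U := Q$; return. - Else if $P+Q\delta < U_j$: $\lambda^j := (U_j-P)/Q$; add $\lambda^j$ to $\mathcal{L}$; $\bar P^j_U := P$, $\bar Q^j_U := Q$; return. - Else: if $\mathcal{D}=\mathcal{A}$, $\delta=\alpha_k^k$: $P := P+l_k$, $Q := Q-a_k$, remove $\alpha_k^k$ from $\mathcal{A}$. If $\mathcal{D}=\mathcal{B}$, $\delta=\beta_k^k$: $P := P-u_k$, $Q := Q+a_k$, remove $\beta_k^k$ from $\mathcal{B}$. If $\mathcal{D}=\mathcal{K}$, $\delta=\kappa^k$: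 $P := P+\bar Q^k_L\kappa^k$, $Q := Q-\bar Q^k_L$, remove $\kappa^k$ from $\mathcal{K}$. If $\mathcal{D}=\mathcal{L}$, $\delta=\lambda^k$: $P := P-\bar Q^k_U\lambda^k$, $Q := Q+\bar Q^k_U$, remove $\lambda^k$ from $\mathcal{L}$. *)

theory Defs
  imports "HOL-Library.Extended_Real" "HOL-Library.Landau_Symbols"
begin

section \<open>A random access machine over the extended reals\<close>

text \<open>
  Running times are counted on a unit-cost real RAM. Its memory consists of arrays of natural
  numbers, used for counters and addresses, and arrays of extended reals, used for the data; a
  scalar is the cell 0 of an array. Extended reals are used because the algorithm itself assigns
  \<open>\<infinity>\<close> and \<open>-\<infinity>\<close> to variables. Natural numbers can only be added, subtracted (truncated at 0)
  and halved, and a real number cannot be converted to a natural number.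

  The arrays \<open>NAux m\<close> and \<open>RAux m\<close> are the workspace of the routines that implement the breakpoint
  sets. All other arrays are variables of the algorithm.
\<close>

datatype nvar =
    VN | VI | VJ | VDone
  | ArgSet | ArgIdx
  | Found | ResSet | ResIdx
  | NAux nat

datatype rvar =
    Va | VL | VU | Vl | Vu
  | Alpha | Beta | Kappa | Lambda
  | PL | QL | PU | QU
  | VS | VT | VP | VQ
  | Chi | VX
  | ArgKey
  | Delta
  | RAux nat

record state =
  nmem :: "nvar \<Rightarrow> nat \<Rightarrow> nat"
  rmem :: "rvar \<Rightarrow> nat \<Rightarrow> ereal"

datatype nexp =
    NNum nat
  | NAt nvar nexp
  | NPlus nexp nexp (infixl "[+]" 65)
  | NMinus nexp nexp (infixl "[-]" 65)
  | NHalf nexp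

datatype rexp =
    RNum int
  | RInfty
  | RAt rvar nexp ("_\<langle>_\<rangle>" [1000, 0] 1000)
  | RPlus rexp rexp (infixl "\<oplus>" 65)
  | RMinus rexp rexp (infixl "\<ominus>" 65)
  | RTimes rexp rexp (infixl "\<otimes>" 70)
  | RDivide rexp rexp (infixl "\<oslash>" 70)
  | RMin rexp rexp
  | RMax rexp rexp

datatype bexp =
    NLess nexp nexp (infix "[<]" 50)
  | NEq nexp nexp (infix "[=]" 50)
  | RLess rexp rexp (infix "\<prec>" 50)
  | RLe rexp rexp (infix "\<preceq>" 50)
  | REq rexp rexp (infix "\<doteq>" 50)
  | BNot bexp
  | BAnd bexp bexp (infixr "[&]" 35)
  | BOr bexp bexp (infixr "[|]" 30)

datatype com =
    Skip
  | Abort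
  | NAssign nvar nexp nexp
  | RAssign rvar nexp rexp ("_\<langle>_\<rangle> ::= _" [1000, 0, 61] 61)
  | Seq com com (infixr ";;" 60)
  | Cond bexp com com ("(IF _/ THEN _/ ELSE _)" [0, 0, 61] 61)
  | While bexp com ("(WHILE _/ DO _)" [0, 61] 61)

fun nval :: "nexp \<Rightarrow> state \<Rightarrow> nat" where
  "nval (NNum m) s = m"
| "nval (NAt v e) s = nmem s v (nval e s)"
| "nval (NPlus e f) s = nval e s + nval f s"
| "nval (NMinus e f) s = nval e s - nval f s"
| "nval (NHalf e) s = nval e s div 2"

fun rval :: "rexp \<Rightarrow> state \<Rightarrow> ereal" where
  "rval (RNum z) s = ereal (of_int z)"
| "rval RInfty s = \<infinity>"
| "rval (RAt v e) s = rmem s v (nval e s)"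
| "rval (RPlus e f) s = rval e s + rval f s"
| "rval (RMinus e f) s = rval e s - rval f s"
| "rval (RTimes e f) s = rval e s * rval f s"
| "rval (RDivide e f) s = rval e s / rval f s"
| "rval (RMin e f) s = min (rval e s) (rval f s)"
| "rval (RMax e f) s = max (rval e s) (rval f s)"

fun bval :: "bexp \<Rightarrow> state \<Rightarrow> bool" where
  "bval (NLess e f) s \<longleftrightarrow> nval e s < nval f s"
| "bval (NEq e f) s \<longleftrightarrow> nval e s = nval f s"
| "bval (RLess e f) s \<longleftrightarrow> rval e s < rval f s"
| "bval (RLe e f) s \<longleftrightarrow> rval e s \<le> rval f s"
| "bval (REq e f) s \<longleftrightarrow> rval e s = rval f s"
| "bval (BNot b) s \<longleftrightarrow> \<not> bval b s"
| "bval (BAnd b c) s \<longleftrightarrow> bval b s \<and> bval c s"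
| "bval (BOr b c) s \<longleftrightarrow> bval b s \<or> bval c s"

definition nupd :: "nvar \<Rightarrow> nat \<Rightarrow> nat \<Rightarrow> state \<Rightarrow> state" where
  "nupd v i x s = s\<lparr>nmem := (nmem s)(v := (nmem s v)(i := x))\<rparr>"

definition rupd :: "rvar \<Rightarrow> nat \<Rightarrow> ereal \<Rightarrow> state \<Rightarrow> state" where
  "rupd v i x s = s\<lparr>rmem := (rmem s)(v := (rmem s v)(i := x))\<rparr>"

datatype outcome = Done state | Aborted state

text \<open>
  \<open>exec c s k r\<close>: started in \<open>s\<close>, the program \<open>c\<close> halts after \<open>k\<close> steps with outcome \<open>r\<close>.
  Every assignment and every test costs one step. As a program is one fixed piece of syntax, which
  does not depend on the input, its expressions have bounded size, so charging for every single
  operation in them would change running times by a constant factor only.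
\<close>

inductive exec :: "com \<Rightarrow> state \<Rightarrow> nat \<Rightarrow> outcome \<Rightarrow> bool" where
  Skip: "exec Skip s 1 (Done s)"
| Abort: "exec Abort s 1 (Aborted s)"
| NAssign: "exec (NAssign v e f) s 1 (Done (nupd v (nval e s) (nval f s) s))"
| RAssign: "exec (RAssign v e f) s 1 (Done (rupd v (nval e s) (rval f s) s))"
| Seq: "exec c s k (Done s') \<Longrightarrow> exec d s' m r \<Longrightarrow> exec (Seq c d) s (k + m) r"
| SeqAbort: "exec c s k (Aborted s') \<Longrightarrow> exec (Seq c d) s k (Aborted s')"
| CondTrue: "bval b s \<Longrightarrow> exec c s k r \<Longrightarrow> exec (Cond b c d) s (k + 1) r"
| CondFalse: "\<not> bval b s \<Longrightarrow> exec d s k r \<Longrightarrow> exec (Cond b c d) s (k + 1) r"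
| WhileFalse: "\<not> bval b s \<Longrightarrow> exec (While b c) s 1 (Done s)"
| WhileTrue: "bval b s \<Longrightarrow> exec (Seq c (While b c)) s k r \<Longrightarrow> exec (While b c) s (k + 1) r"

inductive_cases exec_SkipE: "exec Skip s k r"
inductive_cases exec_AbortE: "exec Abort s k r"
inductive_cases exec_NAssignE: "exec (NAssign v e f) s k r"
inductive_cases exec_RAssignE: "exec (RAssign v e f) s k r"
inductive_cases exec_SeqE: "exec (Seq c d) s k r"
inductive_cases exec_CondE: "exec (Cond b c d) s k r"
inductive_cases exec_WhileE: "exec (While b c) s k r"

text \<open>The machine is deterministic, so ``the'' running time of a halting program is well defined.\<close>

lemma exec_deterministic:
  "exec c s k r \<Longrightarrow> exec c s k' r' \<Longrightarrow> k' = k \<and> r' = r"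
proof (induction arbitrary: k' r' rule: exec.induct)
  case (Seq c s k s' d m r)
  from Seq.prems show ?case
    by (rule exec_SeqE) (auto dest: Seq.IH)
next
  case (SeqAbort c s k s' d)
  from SeqAbort.prems show ?case
    by (rule exec_SeqE) (auto dest: SeqAbort.IH)
next
  case (CondTrue b s c k r d)
  from CondTrue.prems show ?case
    by (rule exec_CondE) (auto simp: CondTrue.hyps dest: CondTrue.IH)
next
  case (CondFalse b s d k r c)
  from CondFalse.prems show ?case
    by (rule exec_CondE) (auto simp: CondFalse.hyps dest: CondFalse.IH)
next
  case (WhileFalse b s c)
  from WhileFalse.prems show ?case
    by (rule exec_WhileE) (auto simp: WhileFalse.hyps)
next
  case (WhileTrue b s c k r)
  from WhileTrue.prems show ?case
    by (rule exec_WhileE) (auto simp: WhileTrue.hyps dest: WhileTrue.IH)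
qed (auto elim: exec_SkipE exec_AbortE exec_NAssignE exec_RAssignE)

section \<open>The breakpoint sets\<close>

text \<open>
  A breakpoint is identified by a pair of the set it belongs to and its index: \<open>(setA, k)\<close> is
  \<open>\<alpha>\<^sub>k\<^sup>k\<close>, \<open>(setB, k)\<close> is \<open>\<beta>\<^sub>k\<^sup>k\<close>, \<open>(setK, k)\<close> is \<open>\<kappa>\<^sup>k\<close> and \<open>(setL, k)\<close> is \<open>\<lambda>\<^sup>k\<close>. The current contents of
  the four sets together is the finite map from the breakpoints present to their values.
\<close>

definition setA :: nat where "setA = 0"
definition setB :: nat where "setB = 1"
definition setK :: nat where "setK = 2"
definition setL :: nat where "setL = 3"

type_synonym breakpoints = "nat \<times> nat \<rightharpoonup> ereal"

definition is_breakpoint :: "nat \<Rightarrow> nat \<times> nat \<Rightarrow> bool" where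
  "is_breakpoint n p \<longleftrightarrow> fst p \<in> {setA, setB, setK, setL} \<and> 1 \<le> snd p \<and> snd p \<le> n"

definition is_minimum :: "breakpoints \<Rightarrow> nat \<times> nat \<Rightarrow> ereal \<Rightarrow> bool" where
  "is_minimum M p x \<longleftrightarrow> M p = Some x \<and> (\<forall>y \<in> ran M. x \<le> y)"

definition is_maximum :: "breakpoints \<Rightarrow> nat \<times> nat \<Rightarrow> ereal \<Rightarrow> bool" where
  "is_maximum M p x \<longleftrightarrow> M p = Some x \<and> (\<forall>y \<in> ran M. y \<le> x)"

text \<open>
  An implementation of the breakpoint sets consists of machine programs for the operations that the
  algorithm performs on them. Arguments are passed in \<open>ArgSet\<close>, \<open>ArgIdx\<close> and \<open>ArgKey\<close>; a query
  answers in \<open>Found\<close>, \<open>ResSet\<close>, \<open>ResIdx\<close> and \<open>Delta\<close>.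
\<close>

record bp_impl =
  bp_init :: com
  bp_add :: com
  bp_remove :: com
  bp_min :: com
  bp_max :: com

definition same_workspace :: "state \<Rightarrow> state \<Rightarrow> bool" where
  "same_workspace s t \<longleftrightarrow>
     (\<forall>m. nmem s (NAux m) = nmem t (NAux m)) \<and> (\<forall>m. rmem s (RAux m) = rmem t (RAux m))"

definition unchanged_except :: "nvar set \<Rightarrow> rvar set \<Rightarrow> state \<Rightarrow> state \<Rightarrow> bool" where
  "unchanged_except X Y s t \<longleftrightarrow>
     (\<forall>v. v \<notin> range NAux \<union> X \<longrightarrow> nmem t v = nmem s v) \<and>
     (\<forall>v. v \<notin> range RAux \<union> Y \<longrightarrow> rmem t v = rmem s v)"

definition bp_arg :: "state \<Rightarrow> nat \<times> nat" where
  "bp_arg s = (nmem s ArgSet 0, nmem s ArgIdx 0)"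

definition bp_answer :: "state \<Rightarrow> nat \<times> nat" where
  "bp_answer s = (nmem s ResSet 0, nmem s ResIdx 0)"

text \<open>
  Correctness of an implementation, as a data refinement: \<open>rep s M\<close> says that the workspace of the
  machine state \<open>s\<close> represents the breakpoints \<open>M\<close>. Only \<open>n\<close>, which the algorithm never changes,
  is visible to \<open>rep\<close> besides the workspace. The routines write no variable of the algorithm
  apart from the answers of the queries.
\<close>

definition represents_breakpoints ::
  "bp_impl \<Rightarrow> (state \<Rightarrow> breakpoints \<Rightarrow> bool) \<Rightarrow> bool" where
  "represents_breakpoints D rep \<longleftrightarrow>
     (\<forall>s t M. rep s M \<longrightarrow> same_workspace s t \<longrightarrow> nmem s VN 0 = nmem t VN 0 \<longrightarrow> rep t M) \<and>
     (\<forall>s. \<exists>k t. exec (bp_init D) s k (Done t) \<and>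
        unchanged_except {} {} s t \<and> rep t Map.empty) \<and>
     (\<forall>s M. rep s M \<longrightarrow> is_breakpoint (nmem s VN 0) (bp_arg s) \<longrightarrow>
        (\<exists>k t. exec (bp_add D) s k (Done t) \<and>
           unchanged_except {} {} s t \<and> rep t (M(bp_arg s \<mapsto> rmem s ArgKey 0)))) \<and>
     (\<forall>s M. rep s M \<longrightarrow> is_breakpoint (nmem s VN 0) (bp_arg s) \<longrightarrow>
        (\<exists>k t. exec (bp_remove D) s k (Done t) \<and>
           unchanged_except {} {} s t \<and> rep t (M(bp_arg s := None)))) \<and>
     (\<forall>s M. rep s M \<longrightarrow>
        (\<exists>k t. exec (bp_min D) s k (Done t) \<and>
           unchanged_except {Found, ResSet, ResIdx} {Delta} s t \<and> rep t M \<and>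
           (if M = Map.empty then nmem t Found 0 = 0
            else nmem t Found 0 = 1 \<and> is_minimum M (bp_answer t) (rmem t Delta 0)))) \<and>
     (\<forall>s M. rep s M \<longrightarrow>
        (\<exists>k t. exec (bp_max D) s k (Done t) \<and>
           unchanged_except {Found, ResSet, ResIdx} {Delta} s t \<and> rep t M \<and>
           (if M = Map.empty then nmem t Found 0 = 0
            else nmem t Found 0 = 1 \<and> is_maximum M (bp_answer t) (rmem t Delta 0))))"

definition implements_breakpoints :: "bp_impl \<Rightarrow> bool" where
  "implements_breakpoints D \<longleftrightarrow> (\<exists>rep. represents_breakpoints D rep)"

section \<open>The algorithm\<close>

abbreviation nn :: nexp where "nn \<equiv> NAt VN (NNum 0)"
abbreviation ii :: nexp where "ii \<equiv> NAt VI (NNum 0)"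
abbreviation jj :: nexp where "jj \<equiv> NAt VJ (NNum 0)"
abbreviation jp :: nexp where "jp \<equiv> jj [-] NNum 1"
abbreviation kk :: nexp where "kk \<equiv> NAt ResIdx (NNum 0)"
abbreviation finished :: nexp where "finished \<equiv> NAt VDone (NNum 0)"
abbreviation the_set :: nexp where "the_set \<equiv> NAt ResSet (NNum 0)"
abbreviation found :: nexp where "found \<equiv> NAt Found (NNum 0)"

abbreviation SS :: rexp where "SS \<equiv> VS\<langle>NNum 0\<rangle>"
abbreviation TT :: rexp where "TT \<equiv> VT\<langle>NNum 0\<rangle>"
abbreviation PP :: rexp where "PP \<equiv> VP\<langle>NNum 0\<rangle>"
abbreviation QQ :: rexp where "QQ \<equiv> VQ\<langle>NNum 0\<rangle>"
abbreviation dd :: rexp where "dd \<equiv> Delta\<langle>NNum 0\<rangle>"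

abbreviation set_n :: "nvar \<Rightarrow> nexp \<Rightarrow> com" (infix "[\<leftarrow>]" 61) where
  "v [\<leftarrow>] e \<equiv> NAssign v (NNum 0) e"
abbreviation set_r :: "rvar \<Rightarrow> rexp \<Rightarrow> com" (infix "\<leftarrow>" 61) where
  "v \<leftarrow> e \<equiv> RAssign v (NNum 0) e"

definition for_up :: "nvar \<Rightarrow> nexp \<Rightarrow> nexp \<Rightarrow> com \<Rightarrow> com" where
  "for_up v lo hi c =
     (v [\<leftarrow>] lo ;;
      WHILE BNot (hi [<] NAt v (NNum 0)) DO
        (c ;; v [\<leftarrow>] NAt v (NNum 0) [+] NNum 1))"

text \<open>Counts down to 1.\<close>

definition for_down :: "nvar \<Rightarrow> nexp \<Rightarrow> com \<Rightarrow> com" where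
  "for_down v hi c =
     (v [\<leftarrow>] hi ;;
      WHILE NNum 0 [<] NAt v (NNum 0) DO
        (c ;; v [\<leftarrow>] NAt v (NNum 0) [-] NNum 1))"

definition add_bp :: "bp_impl \<Rightarrow> nat \<Rightarrow> nexp \<Rightarrow> rexp \<Rightarrow> com" where
  "add_bp D S i e =
     (ArgSet [\<leftarrow>] NNum S ;; ArgIdx [\<leftarrow>] i ;; ArgKey \<leftarrow> e ;; bp_add D)"

definition remove_bp :: "bp_impl \<Rightarrow> nat \<Rightarrow> nexp \<Rightarrow> com" where
  "remove_bp D S i = (ArgSet [\<leftarrow>] NNum S ;; ArgIdx [\<leftarrow>] i ;; bp_remove D)"

definition clamp :: "rexp \<Rightarrow> rexp" where
  "clamp e = RMax (Vl\<langle>jj\<rangle>) (RMin (Va\<langle>jj\<rangle> \<otimes> e) (Vu\<langle>jj\<rangle>))"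

text \<open>
  The minimum of all breakpoints does not exist if all four sets are empty; the run is then
  aborted. Likewise for the maximum in the other subproblem. A division by \<open>Q = 0\<close> follows the
  conventions of \<^typ>\<open>ereal\<close>.
\<close>

definition lower_subproblem :: "bp_impl \<Rightarrow> com" where
  "lower_subproblem D =
    (VDone [\<leftarrow>] NNum 0 ;;
     WHILE finished [=] NNum 0 DO
      (bp_min D ;;
       IF found [=] NNum 0 THEN Abort
       ELSE (IF PP \<oplus> QQ \<otimes> dd \<doteq> VL\<langle>jj\<rangle> THEN
         (Kappa\<langle>jj\<rangle> ::= dd ;;
          add_bp D setK jj (Kappa\<langle>jj\<rangle>) ;;
          PL\<langle>jj\<rangle> ::= PP ;; QL\<langle>jj\<rangle> ::= QQ ;;
          VDone [\<leftarrow>] NNum 1)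
       ELSE (IF VL\<langle>jj\<rangle> \<prec> PP \<oplus> QQ \<otimes> dd THEN
         (Kappa\<langle>jj\<rangle> ::= (VL\<langle>jj\<rangle> \<ominus> PP) \<oslash> QQ ;;
          add_bp D setK jj (Kappa\<langle>jj\<rangle>) ;;
          PL\<langle>jj\<rangle> ::= PP ;; QL\<langle>jj\<rangle> ::= QQ ;;
          VDone [\<leftarrow>] NNum 1)
       ELSE (IF the_set [=] NNum setA THEN
         (VP \<leftarrow> PP \<ominus> Vl\<langle>kk\<rangle> ;;
          VQ \<leftarrow> QQ \<oplus> Va\<langle>kk\<rangle> ;;
          remove_bp D setA kk)
       ELSE (IF the_set [=] NNum setB THEN
         (VP \<leftarrow> PP \<oplus> Vu\<langle>kk\<rangle> ;;
          VQ \<leftarrow> QQ \<ominus> Va\<langle>kk\<rangle> ;;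
          remove_bp D setB kk)
       ELSE (IF the_set [=] NNum setK THEN
         (VP \<leftarrow> PP \<ominus> QL\<langle>kk\<rangle> \<otimes> Kappa\<langle>kk\<rangle> ;;
          VQ \<leftarrow> QQ \<oplus> QL\<langle>kk\<rangle> ;;
          remove_bp D setK kk)
       ELSE
         (VP \<leftarrow> PP \<oplus> QU\<langle>kk\<rangle> \<otimes> Lambda\<langle>kk\<rangle> ;;
          VQ \<leftarrow> QQ \<ominus> QU\<langle>kk\<rangle> ;;
          remove_bp D setL kk))))))))"

definition upper_subproblem :: "bp_impl \<Rightarrow> com" where
  "upper_subproblem D =
    (VDone [\<leftarrow>] NNum 0 ;;
     WHILE finished [=] NNum 0 DO
      (bp_max D ;;
       IF found [=] NNum 0 THEN Abort
       ELSE (IF PP \<oplus> QQ \<otimes> dd \<doteq> VU\<langle>jj\<rangle> THEN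
         (Lambda\<langle>jj\<rangle> ::= dd ;;
          add_bp D setL jj (Lambda\<langle>jj\<rangle>) ;;
          PU\<langle>jj\<rangle> ::= PP ;; QU\<langle>jj\<rangle> ::= QQ ;;
          VDone [\<leftarrow>] NNum 1)
       ELSE (IF PP \<oplus> QQ \<otimes> dd \<prec> VU\<langle>jj\<rangle> THEN
         (Lambda\<langle>jj\<rangle> ::= (VU\<langle>jj\<rangle> \<ominus> PP) \<oslash> QQ ;;
          add_bp D setL jj (Lambda\<langle>jj\<rangle>) ;;
          PU\<langle>jj\<rangle> ::= PP ;; QU\<langle>jj\<rangle> ::= QQ ;;
          VDone [\<leftarrow>] NNum 1)
       ELSE (IF the_set [=] NNum setA THEN
         (VP \<leftarrow> PP \<oplus> Vl\<langle>kk\<rangle> ;;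
          VQ \<leftarrow> QQ \<ominus> Va\<langle>kk\<rangle> ;;
          remove_bp D setA kk)
       ELSE (IF the_set [=] NNum setB THEN
         (VP \<leftarrow> PP \<ominus> Vu\<langle>kk\<rangle> ;;
          VQ \<leftarrow> QQ \<oplus> Va\<langle>kk\<rangle> ;;
          remove_bp D setB kk)
       ELSE (IF the_set [=] NNum setK THEN
         (VP \<leftarrow> PP \<oplus> QL\<langle>kk\<rangle> \<otimes> Kappa\<langle>kk\<rangle> ;;
          VQ \<leftarrow> QQ \<ominus> QL\<langle>kk\<rangle> ;;
          remove_bp D setK kk)
       ELSE
         (VP \<leftarrow> PP \<ominus> QU\<langle>kk\<rangle> \<otimes> Lambda\<langle>kk\<rangle> ;;
          VQ \<leftarrow> QQ \<oplus> QU\<langle>kk\<rangle> ;;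
          remove_bp D setL kk))))))))"

definition lower_update :: "bp_impl \<Rightarrow> com" where
  "lower_update D =
    (VS \<leftarrow> VL\<langle>jp\<rangle> \<oplus> clamp (Kappa\<langle>jp\<rangle>) ;;
     IF SS \<doteq> VL\<langle>jj\<rangle> THEN
      (Kappa\<langle>jj\<rangle> ::= Kappa\<langle>jp\<rangle> ;;
       remove_bp D setK jp ;;
       add_bp D setK jj (Kappa\<langle>jj\<rangle>) ;;
       IF Kappa\<langle>jj\<rangle> \<prec> Alpha\<langle>jj\<rangle> THEN
         (PL\<langle>jj\<rangle> ::= PL\<langle>jp\<rangle> \<oplus> Vl\<langle>jj\<rangle> ;; QL\<langle>jj\<rangle> ::= QL\<langle>jp\<rangle>)
       ELSE (IF Beta\<langle>jj\<rangle> \<prec> Kappa\<langle>jj\<rangle> THEN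
         (PL\<langle>jj\<rangle> ::= PL\<langle>jp\<rangle> \<oplus> Vu\<langle>jj\<rangle> ;; QL\<langle>jj\<rangle> ::= QL\<langle>jp\<rangle>)
       ELSE
         (PL\<langle>jj\<rangle> ::= PL\<langle>jp\<rangle> ;; QL\<langle>jj\<rangle> ::= QL\<langle>jp\<rangle> \<oplus> Va\<langle>jj\<rangle>)))
     ELSE (IF VL\<langle>jj\<rangle> \<prec> SS THEN
      (Kappa\<langle>jj\<rangle> ::= (VL\<langle>jj\<rangle> \<ominus> VL\<langle>jp\<rangle>) \<oslash> Va\<langle>jj\<rangle> ;;
       PL\<langle>jj\<rangle> ::= VL\<langle>jp\<rangle> ;; QL\<langle>jj\<rangle> ::= Va\<langle>jj\<rangle> ;;
       add_bp D setK jj (Kappa\<langle>jj\<rangle>))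
     ELSE remove_bp D setK jp))"

definition upper_update :: "bp_impl \<Rightarrow> com" where
  "upper_update D =
    (VT \<leftarrow> VU\<langle>jp\<rangle> \<oplus> clamp (Lambda\<langle>jp\<rangle>) ;;
     IF TT \<doteq> VU\<langle>jj\<rangle> THEN
      (Lambda\<langle>jj\<rangle> ::= Lambda\<langle>jp\<rangle> ;;
       remove_bp D setL jp ;;
       add_bp D setL jj (Lambda\<langle>jj\<rangle>) ;;
       IF Lambda\<langle>jj\<rangle> \<prec> Alpha\<langle>jj\<rangle> THEN
         (PU\<langle>jj\<rangle> ::= PU\<langle>jp\<rangle> \<oplus> Vl\<langle>jj\<rangle> ;; QU\<langle>jj\<rangle> ::= QU\<langle>jp\<rangle>)
       ELSE (IF Beta\<langle>jj\<rangle> \<prec> Lambda\<langle>jj\<rangle> THEN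
         (PU\<langle>jj\<rangle> ::= PU\<langle>jp\<rangle> \<oplus> Vu\<langle>jj\<rangle> ;; QU\<langle>jj\<rangle> ::= QU\<langle>jp\<rangle>)
       ELSE
         (PU\<langle>jj\<rangle> ::= PU\<langle>jp\<rangle> ;; QU\<langle>jj\<rangle> ::= QU\<langle>jp\<rangle> \<oplus> Va\<langle>jj\<rangle>)))
     ELSE (IF TT \<prec> VU\<langle>jj\<rangle> THEN
      (Lambda\<langle>jj\<rangle> ::= (VU\<langle>jj\<rangle> \<ominus> VU\<langle>jp\<rangle>) \<oslash> Va\<langle>jj\<rangle> ;;
       PU\<langle>jj\<rangle> ::= VU\<langle>jp\<rangle> ;; QU\<langle>jj\<rangle> ::= Va\<langle>jj\<rangle> ;;
       add_bp D setL jj (Lambda\<langle>jj\<rangle>))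
     ELSE remove_bp D setL jp))"

definition add_alpha_beta :: "bp_impl \<Rightarrow> com" where
  "add_alpha_beta D =
    ((IF RMin (Kappa\<langle>jp\<rangle>) (Kappa\<langle>jj\<rangle>) \<prec> Alpha\<langle>jj\<rangle> [&]
         Alpha\<langle>jj\<rangle> \<preceq> RMax (Lambda\<langle>jp\<rangle>) (Lambda\<langle>jj\<rangle>)
      THEN add_bp D setA jj (Alpha\<langle>jj\<rangle>) ELSE Skip) ;;
     (IF RMin (Kappa\<langle>jp\<rangle>) (Kappa\<langle>jj\<rangle>) \<preceq> Beta\<langle>jj\<rangle> [&]
         Beta\<langle>jj\<rangle> \<prec> RMax (Lambda\<langle>jp\<rangle>) (Lambda\<langle>jj\<rangle>)
      THEN add_bp D setB jj (Beta\<langle>jj\<rangle>) ELSE Skip))"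

definition lower_call :: "bp_impl \<Rightarrow> com" where
  "lower_call D =
    (IF Lambda\<langle>jp\<rangle> \<prec> Kappa\<langle>jj\<rangle> THEN
      ((IF Kappa\<langle>jp\<rangle> \<prec> Alpha\<langle>jj\<rangle> THEN
          (VP \<leftarrow> PL\<langle>jp\<rangle> \<oplus> Vl\<langle>jj\<rangle> ;; VQ \<leftarrow> QL\<langle>jp\<rangle>)
        ELSE (IF Kappa\<langle>jp\<rangle> \<prec> Beta\<langle>jj\<rangle> THEN
          (VP \<leftarrow> PL\<langle>jp\<rangle> ;; VQ \<leftarrow> QL\<langle>jp\<rangle> \<oplus> Va\<langle>jj\<rangle>)
        ELSE
          (VP \<leftarrow> PL\<langle>jp\<rangle> \<oplus> Vu\<langle>jj\<rangle> ;; VQ \<leftarrow> QL\<langle>jp\<rangle>))) ;;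
       lower_subproblem D)
     ELSE Skip)"

definition upper_call :: "bp_impl \<Rightarrow> com" where
  "upper_call D =
    (IF Lambda\<langle>jj\<rangle> \<prec> Lambda\<langle>jp\<rangle> THEN
      ((IF Beta\<langle>jj\<rangle> \<prec> Lambda\<langle>jp\<rangle> THEN
          (VP \<leftarrow> PU\<langle>jp\<rangle> \<oplus> Vu\<langle>jj\<rangle> ;; VQ \<leftarrow> QU\<langle>jp\<rangle>)
        ELSE (IF Alpha\<langle>jj\<rangle> \<prec> Lambda\<langle>jp\<rangle> THEN
          (VP \<leftarrow> PU\<langle>jp\<rangle> ;; VQ \<leftarrow> QU\<langle>jp\<rangle> \<oplus> Va\<langle>jj\<rangle>)
        ELSE
          (VP \<leftarrow> PU\<langle>jp\<rangle> \<oplus> Vl\<langle>jj\<rangle> ;; VQ \<leftarrow> QU\<langle>jp\<rangle>))) ;;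
       upper_subproblem D)
     ELSE Skip)"

definition solve_subproblems :: "bp_impl \<Rightarrow> com" where
  "solve_subproblems D =
    (lower_update D ;;
     upper_update D ;;
     add_alpha_beta D ;;
     lower_call D ;;
     upper_call D)"

definition tighten_bounds :: com where
  "tighten_bounds =
    (VL\<langle>NNum 1\<rangle> ::= RMax (VL\<langle>NNum 1\<rangle>) (Vl\<langle>NNum 1\<rangle>) ;;
     VU\<langle>NNum 1\<rangle> ::= RMin (VU\<langle>NNum 1\<rangle>) (Vu\<langle>NNum 1\<rangle>) ;;
     for_up VJ (NNum 2) nn
      (VL\<langle>jj\<rangle> ::= RMax (VL\<langle>jj\<rangle>) (VL\<langle>jp\<rangle> \<oplus> Vl\<langle>jj\<rangle>) ;;
       VU\<langle>jj\<rangle> ::= RMin (VU\<langle>jj\<rangle>) (VU\<langle>jp\<rangle> \<oplus> Vu\<langle>jj\<rangle>)))"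

definition initialize :: "bp_impl \<Rightarrow> com" where
  "initialize D =
    (for_up VI (NNum 1) nn
      (Alpha\<langle>ii\<rangle> ::= Vl\<langle>ii\<rangle> \<oslash> Va\<langle>ii\<rangle> ;;
       Beta\<langle>ii\<rangle> ::= Vu\<langle>ii\<rangle> \<oslash> Va\<langle>ii\<rangle>) ;;
     Kappa\<langle>NNum 1\<rangle> ::= Alpha\<langle>NNum 1\<rangle> ;;
     Lambda\<langle>NNum 1\<rangle> ::= Beta\<langle>NNum 1\<rangle> ;;
     for_up VJ (NNum 2) nn
      (Kappa\<langle>jj\<rangle> ::= RInfty ;;
       Lambda\<langle>jj\<rangle> ::= RNum 0 \<ominus> RInfty) ;;
     bp_init D ;;
     add_bp D setA (NNum 1) (Alpha\<langle>NNum 1\<rangle>) ;;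
     add_bp D setB (NNum 1) (Beta\<langle>NNum 1\<rangle>) ;;
     PL\<langle>NNum 1\<rangle> ::= RNum 0 ;;
     PU\<langle>NNum 1\<rangle> ::= RNum 0 ;;
     QL\<langle>NNum 1\<rangle> ::= Va\<langle>NNum 1\<rangle> ;;
     QU\<langle>NNum 1\<rangle> ::= Va\<langle>NNum 1\<rangle>)"

definition recover_solution :: com where
  "recover_solution =
    (Chi\<langle>nn\<rangle> ::= Kappa\<langle>nn\<rangle> ;;
     for_down VI (nn [-] NNum 1)
      (IF Chi\<langle>ii [+] NNum 1\<rangle> \<preceq> Kappa\<langle>ii\<rangle> THEN Chi\<langle>ii\<rangle> ::= Kappa\<langle>ii\<rangle>
       ELSE (IF Lambda\<langle>ii\<rangle> \<preceq> Chi\<langle>ii [+] NNum 1\<rangle> THEN Chi\<langle>ii\<rangle> ::= Lambda\<langle>ii\<rangle>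
       ELSE Chi\<langle>ii\<rangle> ::= Chi\<langle>ii [+] NNum 1\<rangle>)) ;;
     for_up VI (NNum 1) nn
      (IF Chi\<langle>ii\<rangle> \<prec> Alpha\<langle>ii\<rangle> THEN VX\<langle>ii\<rangle> ::= Vl\<langle>ii\<rangle>
       ELSE (IF Chi\<langle>ii\<rangle> \<prec> Beta\<langle>ii\<rangle> THEN VX\<langle>ii\<rangle> ::= Va\<langle>ii\<rangle> \<otimes> Chi\<langle>ii\<rangle>
       ELSE VX\<langle>ii\<rangle> ::= Vu\<langle>ii\<rangle>)))"

definition alg_seq :: "bp_impl \<Rightarrow> com" where
  "alg_seq D =
    (tighten_bounds ;;
     initialize D ;;
     for_up VJ (NNum 2) nn (solve_subproblems D) ;;
     recover_solution)"

section \<open>Instances\<close>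

text \<open>
  Vectors are indexed from 1; entries outside the index ranges of the problem are irrelevant.
  The bounds on the partial sums are given for \<open>j = 1, \<dots>, n - 1\<close> only.
\<close>

record qrap_nc =
  qa :: "nat \<Rightarrow> real"
  qL :: "nat \<Rightarrow> real"
  qU :: "nat \<Rightarrow> real"
  qR :: real
  ql :: "nat \<Rightarrow> real"
  qu :: "nat \<Rightarrow> real"

definition qrap_nc_instance :: "nat \<Rightarrow> qrap_nc \<Rightarrow> bool" where
  "qrap_nc_instance n I \<longleftrightarrow>
     1 \<le> n \<and> (\<forall>i \<in> {1..n}. 0 < qa I i) \<and> (\<forall>j \<in> {1..<n}. qL I j < qU I j)"

text \<open>Memory holding the input, with \<open>L\<^sub>n = U\<^sub>n = R\<close>, and 0 everywhere else.\<close>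

definition input_rmem :: "nat \<Rightarrow> qrap_nc \<Rightarrow> rvar \<Rightarrow> nat \<Rightarrow> ereal" where
  "input_rmem n I v i =
     (if 1 \<le> i \<and> i \<le> n then
        ereal (case v of
            Va \<Rightarrow> qa I i
          | VL \<Rightarrow> (if i = n then qR I else qL I i)
          | VU \<Rightarrow> (if i = n then qR I else qU I i)
          | Vl \<Rightarrow> ql I i
          | Vu \<Rightarrow> qu I i
          | _ \<Rightarrow> 0)
      else 0)"

definition input_state :: "nat \<Rightarrow> qrap_nc \<Rightarrow> state" where
  "input_state n I =
     \<lparr>nmem = (\<lambda>v i. if v = VN \<and> i = 0 then n else 0), rmem = input_rmem n I\<rparr>"

text \<open>
  The time bound covers runs that end in either outcome. By definition of \<open>alg_seq\<close>, a run with
  correctly implemented breakpoint sets ends in \<open>Aborted\<close> only if it asks for the minimum or the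
  maximum of an empty collection of breakpoints.
\<close>

definition runs_in_time :: "com \<Rightarrow> (nat \<Rightarrow> nat) \<Rightarrow> bool" where
  "runs_in_time c T \<longleftrightarrow>
     (\<forall>n I. qrap_nc_instance n I \<longrightarrow> (\<exists>k r. exec c (input_state n I) k r \<and> k \<le> T n))"

end

theory Submission
  imports Defs "HOL-Library.Log_Nat" "HOL-Real_Asymp.Real_Asymp"
begin

text \<open>
  The breakpoints are kept in two tournament trees, one for the minimum and one for the maximum,
  over a table with one place for each of the \<open>O(n)\<close> possible breakpoints. An insertion or deletion
  replays the \<open>O(log n)\<close> games on one path to the root of each tree, and a query reads a root.
  Every call of SolveSubproblems inserts a bounded number of breakpoints, and every iteration of a
  subproblem but its last one deletes a breakpoint that is present. So \<open>O(n)\<close> operations on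
  the trees are executed in total, whatever the values of the breakpoints are.
\<close>

section \<open>Runs within a budget\<close>

text \<open>The obstacle is that a single call of a subproblem may loop linearly often, and that its
  course depends on comparisons of extended reals about which nothing is known; bounding its
  iterations through their values would amount to verifying the algorithm itself. Time is therefore
  treated as a budget. \<open>runs c s b Q\<close> lets \<open>c\<close> halt within
  \<open>b\<close> steps and hands the unspent steps to \<open>Q\<close>; an aborted run satisfies
  every \<open>Q\<close>, because the time bound asks only that some outcome is reached in time. The
  budget is then the termination measure of every loop. Correctness of the trees is used twice: for
  \<open>implements_breakpoints\<close>, and to know that a breakpoint returned by a query is
  present, so that its removal really frees a credit. Constants are step counts, rounded up freely
  once they are multiples of \<open>credit n\<close>.\<close>

definition runs :: "com \<Rightarrow> state \<Rightarrow> nat \<Rightarrow> (state \<Rightarrow> nat \<Rightarrow> bool) \<Rightarrow> bool" where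
  "runs c s b Q \<longleftrightarrow>
     (\<exists>k t. exec c s k (Done t) \<and> k \<le> b \<and> Q t (b - k)) \<or> (\<exists>k t. exec c s k (Aborted t) \<and> k \<le> b)"

lemma runs_DoneI: "exec c s k (Done t) \<Longrightarrow> k \<le> b \<Longrightarrow> Q t (b - k) \<Longrightarrow> runs c s b Q"
  by (auto simp: runs_def)

lemma runs_AbortedI: "exec c s k (Aborted t) \<Longrightarrow> k \<le> b \<Longrightarrow> runs c s b Q"
  by (auto simp: runs_def)

lemma runsE:
  assumes "runs c s b Q"
  obtains (Done) k t where "exec c s k (Done t)" "k \<le> b" "Q t (b - k)"
  | (Aborted) k t where "exec c s k (Aborted t)" "k \<le> b"
  using assms by (auto simp: runs_def)

lemma runs_Skip [simp]: "runs Skip s b Q \<longleftrightarrow> 1 \<le> b \<and> Q s (b - 1)"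
  by (auto elim!: runsE exec_SkipE intro: runs_DoneI[OF exec.Skip])

lemma runs_Abort [simp]: "runs Abort s b Q \<longleftrightarrow> 1 \<le> b"
  by (auto elim!: runsE exec_AbortE intro: runs_AbortedI[OF exec.Abort])

lemma runs_NAssign [simp]:
  "runs (NAssign v e f) s b Q \<longleftrightarrow> 1 \<le> b \<and> Q (nupd v (nval e s) (nval f s) s) (b - 1)"
  by (auto elim!: runsE exec_NAssignE intro: runs_DoneI[OF exec.NAssign])

lemma runs_RAssign [simp]:
  "runs (RAssign v e f) s b Q \<longleftrightarrow> 1 \<le> b \<and> Q (rupd v (nval e s) (rval f s) s) (b - 1)"
  by (auto elim!: runsE exec_RAssignE intro: runs_DoneI[OF exec.RAssign])

lemma runs_Seq [simp]: "runs (c ;; d) s b Q \<longleftrightarrow> runs c s b (\<lambda>t b'. runs d t b' Q)" (is "?L \<longleftrightarrow> ?R")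
proof
  assume ?L
  then show ?R
  proof (cases rule: runsE)
    case (Done k t)
    from Done(1) show ?thesis
    proof (rule exec_SeqE)
      fix k1 s' m assume *: "k = k1 + m" "exec c s k1 (Done s')" "exec d s' m (Done t)"
      then have "runs d s' (b - k1) Q"
        using Done by (intro runs_DoneI[of _ _ m t]) auto
      with * Done show ?thesis by (auto intro: runs_DoneI)
    qed simp
  next
    case (Aborted k t)
    from Aborted(1) show ?thesis
    proof (rule exec_SeqE)
      fix k1 s' m assume *: "k = k1 + m" "exec c s k1 (Done s')" "exec d s' m (Aborted t)"
      then have "runs d s' (b - k1) Q"
        using Aborted by (intro runs_AbortedI[of _ _ m t]) auto
      with * Aborted show ?thesis by (auto intro: runs_DoneI)
    qed (use Aborted in \<open>auto intro: runs_AbortedI\<close>)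
  qed
next
  assume ?R
  then show ?L
  proof (cases rule: runsE)
    case (Done k t)
    note c = Done
    from c(3) show ?thesis
    proof (cases rule: runsE)
      case (Done k' t')
      then show ?thesis
        using c by (intro runs_DoneI[OF exec.Seq[OF c(1) Done(1)]]) (auto simp: diff_diff_add)
    next
      case (Aborted k' t')
      then show ?thesis
        using c by (intro runs_AbortedI[OF exec.Seq[OF c(1) Aborted(1)]]) auto
    qed
  qed (auto intro: runs_AbortedI exec.SeqAbort)
qed

lemma runs_CondI:
  assumes "1 \<le> b"
    and "bval p s \<Longrightarrow> runs c s (b - 1) Q"
    and "\<not> bval p s \<Longrightarrow> runs d s (b - 1) Q"
  shows "runs (IF p THEN c ELSE d) s b Q"
proof (cases "bval p s")
  case True
  from assms(2)[OF this] show ?thesis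
    by (cases rule: runsE) (use assms(1) True in
      \<open>auto intro: runs_DoneI[OF exec.CondTrue] runs_AbortedI[OF exec.CondTrue]\<close>)
next
  case False
  from assms(3)[OF this] show ?thesis
    by (cases rule: runsE) (use assms(1) False in
      \<open>auto intro: runs_DoneI[OF exec.CondFalse] runs_AbortedI[OF exec.CondFalse]\<close>)
qed

lemma runs_Cond [simp]:
  "runs (IF p THEN c ELSE d) s b Q \<longleftrightarrow>
     1 \<le> b \<and> (if bval p s then runs c s (b - 1) Q else runs d s (b - 1) Q)"
proof
  assume "runs (IF p THEN c ELSE d) s b Q"
  then show "1 \<le> b \<and> (if bval p s then runs c s (b - 1) Q else runs d s (b - 1) Q)"
    by (cases rule: runsE) (auto elim!: exec_CondE intro: runs_AbortedI simp: runs_def)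
qed (auto intro: runs_CondI split: if_splits)

lemma runs_WhileI:
  assumes "1 \<le> b"
    and "bval p s \<Longrightarrow> runs (c ;; WHILE p DO c) s (b - 1) Q"
    and "\<not> bval p s \<Longrightarrow> Q s (b - 1)"
  shows "runs (WHILE p DO c) s b Q"
proof (cases "bval p s")
  case True
  from assms(2)[OF this] show ?thesis
    by (cases rule: runsE)
      (use assms(1) True in \<open>auto intro: runs_DoneI[OF exec.WhileTrue] runs_AbortedI[OF
        exec.WhileTrue]\<close>)
next
  case False
  with assms show ?thesis by (auto intro: runs_DoneI[OF exec.WhileFalse])
qed

lemma runs_mono:
  assumes "runs c s b Q" "\<And>t b'. Q t b' \<Longrightarrow> Q' t b'"
  shows "runs c s b Q'"
  using assms by (auto elim!: runsE intro: runs_DoneI runs_AbortedI)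

text \<open>Turns a specification with its own budget \<open>a\<close> into one that runs inside a
  larger budget. The remainder is described by \<open>b \<le> b' + a\<close>, so that no truncated
  subtraction enters later arithmetic.\<close>

lemma runs_frame:
  assumes "runs c s a (\<lambda>t _. Q t)" "a \<le> b"
  shows "runs c s b (\<lambda>t b'. Q t \<and> b \<le> b' + a)"
  using assms by (auto elim!: runsE intro: runs_DoneI runs_AbortedI)

text \<open>Every iteration costs at least the step of its test, so the budget itself bounds the number
  of iterations.\<close>

lemma runs_While:
  assumes "Inv s b"
    and pos: "\<And>s b. Inv s b \<Longrightarrow> 1 \<le> b"
    and step: "\<And>s b. Inv s b \<Longrightarrow> bval p s \<Longrightarrow> runs c s (b - 1) Inv"
    and stop: "\<And>s b. Inv s b \<Longrightarrow> \<not> bval p s \<Longrightarrow> Q s (b - 1)"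
  shows "runs (WHILE p DO c) s b Q"
  using assms(1)
proof (induction b arbitrary: s rule: less_induct)
  case (less b)
  have "1 \<le> b" using pos less.prems .
  show ?case
  proof (rule runs_WhileI)
    assume "bval p s"
    from step[OF less.prems this] have "runs c s (b - 1) (\<lambda>t b'. runs (WHILE p DO c) t b' Q)"
      using less.IH \<open>1 \<le> b\<close> by (auto elim!: runsE intro: runs_DoneI runs_AbortedI)
    then show "runs (c ;; WHILE p DO c) s (b - 1) Q" by simp
  qed (use \<open>1 \<le> b\<close> stop less.prems in auto)
qed

section \<open>From budgets to guaranteed normal termination\<close>

fun abort_free :: "com \<Rightarrow> bool" where
  "abort_free Abort = False"
| "abort_free (Seq c d) = (abort_free c \<and> abort_free d)"
| "abort_free (Cond b c d) = (abort_free c \<and> abort_free d)"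
| "abort_free (While b c) = abort_free c"
| "abort_free _ = True"

lemma abort_free_Done: "exec c s k r \<Longrightarrow> abort_free c \<Longrightarrow> \<exists>t. r = Done t"
  by (induction rule: exec.induct) auto

text \<open>\<open>represents_breakpoints\<close> demands a normal end, which \<open>runs\<close>
  alone does not give. The tree programs contain no \<open>Abort\<close>, so the time lemmas yield
  their correctness as well.\<close>

lemma runs_abort_free:
  assumes "runs c s b (\<lambda>t _. Q t)" "abort_free c"
  shows "\<exists>k t. exec c s k (Done t) \<and> Q t"
  using assms abort_free_Done by (blast elim: runsE)

lemma nupd_simps [simp]:
  "nmem (nupd v i x s) = (nmem s)(v := (nmem s v)(i := x))" "rmem (nupd v i x s) = rmem s"
  by (simp_all add: nupd_def)

lemma rupd_simps [simp]:
  "rmem (rupd v i x s) = (rmem s)(v := (rmem s v)(i := x))" "nmem (rupd v i x s) = nmem s"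
  by (simp_all add: rupd_def)

section \<open>Tournament trees\<close>

text \<open>
  Entry \<open>i\<close> of a tree has the children \<open>2 * i\<close> and \<open>2 * i + 1\<close>, the leaves are the entries
  \<open>N, \<dots>, 2 * N - 1\<close>, for an arbitrary \<open>N\<close>, not only a power of two. An entry is the slot that wins
  its subtree, and 0 stands for no slot. Trees with \<open>m = 0\<close> search the minimum, others the maximum.
\<close>

definition precedes :: "nat \<Rightarrow> ereal \<Rightarrow> ereal \<Rightarrow> bool" where
  "precedes m x y \<longleftrightarrow> (if m = 0 then x \<le> y else y \<le> x)"

definition winner :: "nat \<Rightarrow> (nat \<Rightarrow> ereal) \<Rightarrow> nat \<Rightarrow> nat \<Rightarrow> nat" where
  "winner m key x y = (if y = 0 \<or> x \<noteq> 0 \<and> precedes m (key x) (key y) then x else y)"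

definition tournament ::
  "nat \<Rightarrow> nat \<Rightarrow> (nat \<Rightarrow> ereal) \<Rightarrow> nat set \<Rightarrow> (nat \<Rightarrow> nat) \<Rightarrow> bool" where
  "tournament N m key A w \<longleftrightarrow>
     (\<forall>q<N. w (N + q) = (if q \<in> A then q else 0)) \<and>
     (\<forall>i. 1 \<le> i \<longrightarrow> i < N \<longrightarrow> w i = winner m key (w (2 * i)) (w (2 * i + 1)))"

lemma precedes_trans: "precedes m x y \<Longrightarrow> precedes m y z \<Longrightarrow> precedes m x z"
  by (auto simp: precedes_def split: if_splits)

lemma winner_cases: "winner m key x y = x \<or> winner m key x y = y"
  by (simp add: winner_def)

lemma winner_precedes:
  assumes "z \<in> {x, y}" "z \<noteq> 0"
  shows "winner m key x y \<noteq> 0 \<and> precedes m (key (winner m key x y)) (key z)"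
  using assms by (auto simp: winner_def precedes_def)

text \<open>A winner is one of its two children, so a nonzero entry comes from a leaf below it.
  Children have larger indices, hence the measure \<open>2 * N - i\<close>.\<close>

lemma tournament_entry:
  assumes "tournament N m key A w" "1 \<le> i" "i < 2 * N" "w i \<noteq> 0"
  shows "w i \<in> A \<and> w i < N"
  using assms(2-)
proof (induction "2 * N - i" arbitrary: i rule: less_induct)
  case less
  show ?case
  proof (cases "i < N")
    case True
    then have w: "w i = winner m key (w (2 * i)) (w (2 * i + 1))"
      using assms(1) less.prems by (auto simp: tournament_def)
    have "\<exists>j \<in> {2 * i, 2 * i + 1}. w i = w j"
      using winner_cases w by (metis insertCI)
    then obtain j where "j = 2 * i \<or> j = 2 * i + 1" "w i = w j" by blast
    then show ?thesis using less.hyps[of j] less.prems True by auto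
  next
    case False
    then obtain q where "i = N + q" "q < N"
      using less.prems by (intro that[of "i - N"]) auto
    moreover have "\<forall>q<N. w (N + q) = (if q \<in> A then q else 0)"
      using assms(1) by (simp add: tournament_def)
    ultimately show ?thesis using less.prems by (auto split: if_splits)
  qed
qed

text \<open>Follows the path from \<open>i\<close> to its parent \<open>i div 2\<close> up to entry
  1; each entry on the way precedes the one before it, and none of them is 0.\<close>

lemma tournament_root_precedes:
  assumes "tournament N m key A w" "1 \<le> i" "i < 2 * N" "w i \<noteq> 0"
  shows "w 1 \<noteq> 0 \<and> precedes m (key (w 1)) (key (w i))"
  using assms(2-)
proof (induction i rule: less_induct)
  case (less i)
  show ?case
  proof (cases "i = 1")
    case False
    define j where "j = i div 2"
    have j: "1 \<le> j" "j < i" "j < N" and ij: "i = 2 * j \<or> i = 2 * j + 1"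
      using less.prems False by (auto simp: j_def)
    then have "w j = winner m key (w (2 * j)) (w (2 * j + 1))"
      using assms(1) by (simp add: tournament_def)
    then have "w j \<noteq> 0" "precedes m (key (w j)) (key (w i))"
      using winner_precedes[of "w i"] less.prems ij by auto
    then show ?thesis using less.IH[of j] j precedes_trans by auto
  qed (use less.prems in \<open>simp add: precedes_def\<close>)
qed

lemma tournament_leaf_precedes:
  assumes "tournament N m key A w" "q \<in> A" "q < N" "q \<noteq> 0"
  shows "w 1 \<noteq> 0 \<and> precedes m (key (w 1)) (key q)"
  using tournament_root_precedes[OF assms(1), of "N + q"] assms by (simp add: tournament_def)

text \<open>The winner function compares keys only if both candidates are nonzero, hence in
  \<open>A\<close>. So the key of a slot outside the tree can be overwritten without replaying any
  game.\<close>

lemma tournament_cong_key: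
  assumes "tournament N m key A w" "\<And>q. q \<in> A \<Longrightarrow> key' q = key q"
  shows "tournament N m key' A w"
proof -
  have "winner m key' (w (2 * i)) (w (2 * i + 1)) = winner m key (w (2 * i)) (w (2 * i + 1))"
    if "1 \<le> i" "i < N" for i
  proof -
    have "w (2 * i) \<in> A" if "w (2 * i) \<noteq> 0"
      using tournament_entry[OF assms(1) _ _ that] \<open>1 \<le> i\<close> \<open>i < N\<close> by simp
    moreover have "w (2 * i + 1) \<in> A" if "w (2 * i + 1) \<noteq> 0"
      using tournament_entry[OF assms(1) _ _ that] \<open>1 \<le> i\<close> \<open>i < N\<close> by simp
    ultimately show ?thesis
      using assms(2) by (auto simp: winner_def)
  qed
  with assms(1) show ?thesis by (simp add: tournament_def)
qed

section \<open>The implementation of the breakpoint sets\<close>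

text \<open>The breakpoint \<open>(S, k)\<close> occupies the slot \<open>4 * k + S\<close>: it can be decoded by halving, and it is
  never 0, as \<open>k \<ge> 1\<close>.\<close>

definition slot :: "nat \<times> nat \<Rightarrow> nat" where
  "slot p = 4 * snd p + fst p"

abbreviation cap :: "state \<Rightarrow> nat" where "cap s \<equiv> 4 * nmem s VN 0 + 4"

text \<open>Fourfold sums stand for products, as the machine cannot multiply natural
  numbers.\<close>

abbreviation slot_e :: nexp where
  "slot_e \<equiv>
     NAt ArgIdx (NNum 0) [+] NAt ArgIdx (NNum 0) [+] NAt ArgIdx (NNum 0) [+] NAt ArgIdx (NNum 0) [+]
     NAt ArgSet (NNum 0)"
abbreviation leaf_e :: nexp where "leaf_e \<equiv> nn [+] nn [+] nn [+] nn [+] NNum 4 [+] slot_e"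
abbreviation cur :: nexp where "cur \<equiv> NAt (NAux 2) (NNum 0)"
abbreviation key_e :: "nexp \<Rightarrow> rexp" where "key_e e \<equiv> RAt (RAux 0) e"

definition precedes_e :: "nat \<Rightarrow> rexp \<Rightarrow> rexp \<Rightarrow> bexp" where
  "precedes_e m x y = (if m = 0 then x \<preceq> y else y \<preceq> x)"

lemma bval_precedes_e [simp]: "bval (precedes_e m x y) s = precedes m (rval x s) (rval y s)"
  by (simp add: precedes_e_def precedes_def)

definition play :: "nat \<Rightarrow> com" where
  "play m =
    (let x = NAt (NAux m) (cur [+] cur); y = NAt (NAux m) (cur [+] cur [+] NNum 1) in
     IF y [=] NNum 0 [|] (BNot (x [=] NNum 0) [&] precedes_e m (key_e x) (key_e y))
     THEN NAssign (NAux m) cur x ELSE NAssign (NAux m) cur y)"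

definition climb :: "nat \<Rightarrow> com" where
  "climb m = (WHILE NNum 0 [<] cur DO (play m ;; NAux 2 [\<leftarrow>] NHalf cur))"

definition set_leaf :: "nat \<Rightarrow> nexp \<Rightarrow> com" where
  "set_leaf m e =
    (NAssign (NAux m) leaf_e e ;; NAux 2 [\<leftarrow>] NHalf leaf_e ;; climb m)"

definition tree_query :: "nat \<Rightarrow> com" where
  "tree_query m =
    (let w = NAt (NAux m) (NNum 1) in
     IF w [=] NNum 0 THEN Found [\<leftarrow>] NNum 0
     ELSE
      (Found [\<leftarrow>] NNum 1 ;;
       ResIdx [\<leftarrow>] NHalf (NHalf w) ;;
       ResSet [\<leftarrow>] w [-] (kk [+] kk [+] kk [+] kk) ;;
       Delta \<leftarrow> key_e w))"

definition tree_init :: com where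
  "tree_init =
    (NAux 2 [\<leftarrow>] nn [+] nn [+] nn [+] nn [+] NNum 4 ;;
     NAux 2 [\<leftarrow>] cur [+] cur ;;
     WHILE NNum 0 [<] cur DO
      (NAux 2 [\<leftarrow>] cur [-] NNum 1 ;;
       NAssign (NAux 0) cur (NNum 0) ;;
       NAssign (NAux 1) cur (NNum 0)))"

definition tree_remove :: com where
  "tree_remove = (set_leaf 0 (NNum 0) ;; set_leaf 1 (NNum 0))"

text \<open>The old entry is removed before its key is overwritten, since changing the key of a slot in
  the tree would invalidate all games that the slot takes part in.\<close>

definition tree_add :: com where
  "tree_add =
    (tree_remove ;;
     RAssign (RAux 0) slot_e (RAt ArgKey (NNum 0)) ;;
     set_leaf 0 slot_e ;; set_leaf 1 slot_e)"

definition trees :: bp_impl where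
  "trees = \<lparr>bp_init = tree_init, bp_add = tree_add, bp_remove = tree_remove,
     bp_min = tree_query 0, bp_max = tree_query 1\<rparr>"

definition is_tree :: "nat \<Rightarrow> state \<Rightarrow> (nat \<times> nat) set \<Rightarrow> bool" where
  "is_tree m s A \<longleftrightarrow> tournament (cap s) m (rmem s (RAux 0)) (slot ` A) (nmem s (NAux m))"

text \<open>\<open>NAux 0\<close> and \<open>NAux 1\<close> hold the minimum and the maximum tree,
  \<open>NAux 2\<close> is the cursor of the climb, and \<open>RAux 0\<close> is the key table
  shared by both trees. Keys at absent slots are arbitrary, so a removal leaves the table
  alone.\<close>

definition rep :: "state \<Rightarrow> breakpoints \<Rightarrow> bool" where
  "rep s M \<longleftrightarrow> dom M \<subseteq> Collect (is_breakpoint (nmem s VN 0)) \<and>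
     (\<forall>p x. M p = Some x \<longrightarrow> rmem s (RAux 0) (slot p) = x) \<and>
     is_tree 0 s (dom M) \<and> is_tree 1 s (dom M)"

definition only_changes :: "nvar set \<Rightarrow> state \<Rightarrow> state \<Rightarrow> bool" where
  "only_changes X s t \<longleftrightarrow> rmem t = rmem s \<and> (\<forall>v. v \<notin> X \<longrightarrow> nmem t v = nmem s v)"

lemma is_breakpoint_iff: "is_breakpoint n p \<longleftrightarrow> fst p < 4 \<and> 1 \<le> snd p \<and> snd p \<le> n"
  by (auto simp: is_breakpoint_def setA_def setB_def setK_def setL_def)

lemma slot_decode:
  assumes "is_breakpoint n p"
  shows "slot p div 2 div 2 = snd p" "slot p - 4 * snd p = fst p" "slot p \<noteq> 0" "slot p < 4 * n + 4"
  using assms by (auto simp: slot_def is_breakpoint_iff)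

lemma slot_inj_on: "inj_on slot (Collect (is_breakpoint n))"
  by (rule inj_onI) (metis mem_Collect_eq prod_eqI slot_decode(1,2))

lemma only_changes_trans:
  "only_changes X s t \<Longrightarrow> only_changes X t u \<Longrightarrow> only_changes X s u"
  by (simp add: only_changes_def)

text \<open>While the tree is updated along the path to the root, the entry \<open>cur\<close> is the only one that
  may disagree with its children.\<close>

definition games_ok :: "nat \<Rightarrow> nat \<Rightarrow> nat \<Rightarrow> state \<Rightarrow> bool" where
  "games_ok m N c s \<longleftrightarrow> (\<forall>i. 1 \<le> i \<longrightarrow> i < N \<longrightarrow> i \<noteq> c \<longrightarrow>
     nmem s (NAux m) i =
       winner m (rmem s (RAux 0)) (nmem s (NAux m) (2 * i)) (nmem s (NAux m) (2 * i + 1)))"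

text \<open>Entry \<open>i\<close> takes part as a child only in the game of \<open>i div 2\<close>,
  so repairing \<open>i\<close> moves the possible defect to its parent. The three steps are the
  test, one assignment and the halving.\<close>

lemma runs_play:
  assumes "games_ok m N i s" "nmem s (NAux 2) 0 = i" "0 < i" "m < 2"
  shows "runs (play m ;; NAux 2 [\<leftarrow>] NHalf cur) s 3
    (\<lambda>t _. only_changes {NAux m, NAux 2} s t \<and> nmem t (NAux 2) 0 = i div 2 \<and>
      (\<forall>j. j \<noteq> i \<longrightarrow> nmem t (NAux m) j = nmem s (NAux m) j) \<and> games_ok m N (i div 2) t)"
proof -
  define w where "w = nmem s (NAux m)"
  define key where "key = rmem s (RAux 0)"
  define z where "z = winner m key (w (2 * i)) (w (2 * i + 1))"
  have *: "(w(i := z)) j = winner m key ((w(i := z)) (2 * j)) ((w(i := z)) (2 * j + 1))"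
    if j: "1 \<le> j" "j < N" "j \<noteq> i div 2" for j
  proof -
    have "2 * j \<noteq> i" "2 * j + 1 \<noteq> i" using j(3) by auto
    moreover have "w j = winner m key (w (2 * j)) (w (2 * j + 1))" if "j \<noteq> i"
      using assms(1) j that by (simp add: games_ok_def w_def key_def)
    ultimately show ?thesis by (auto simp: z_def)
  qed
  have "nmem t (NAux m) = w(i := z) \<Longrightarrow> rmem t = rmem s \<Longrightarrow> games_ok m N (i div 2) t" for t
    using * by (simp add: games_ok_def key_def)
  then show ?thesis
    using assms(2-) unfolding play_def Let_def
    by (auto simp: only_changes_def w_def key_def z_def mult_2 winner_def)
qed

text \<open>The cursor loses one binary digit per iteration, which takes four steps including the
  loop test. At cursor 0 the exception in \<open>games_ok\<close> lies outside the tree, so all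
  games are right.\<close>

lemma runs_climb:
  assumes "games_ok m N (nmem s (NAux 2) 0) s" "nmem s (NAux 2) 0 < N" "m < 2"
  shows "runs (climb m) s (4 * floorlog 2 (nmem s (NAux 2) 0) + 1)
    (\<lambda>t _. only_changes {NAux m, NAux 2} s t \<and> games_ok m N 0 t \<and>
      (\<forall>i\<ge>N. nmem t (NAux m) i = nmem s (NAux m) i))"
  unfolding climb_def
proof (rule runs_While[where Inv = "\<lambda>t b. only_changes {NAux m, NAux 2} s t \<and>
      games_ok m N (nmem t (NAux 2) 0) t \<and> (\<forall>i\<ge>N. nmem t (NAux m) i = nmem s (NAux m) i) \<and>
      nmem t (NAux 2) 0 < N \<and> 4 * floorlog 2 (nmem t (NAux 2) 0) + 1 \<le> b"], goal_cases)
  case 1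
  then show ?case using assms by (simp add: only_changes_def)
next
  case (3 t b)
  define i where "i = nmem t (NAux 2) 0"
  have i: "0 < i" "i < N" using 3 by (simp_all add: i_def)
  then have "floorlog 2 i = floorlog 2 (i div 2) + 1"
    by (subst compute_floorlog) simp
  with 3(1) have b: "4 * floorlog 2 (i div 2) + 4 \<le> b - 1"
    unfolding i_def by linarith
  have "runs (play m ;; NAux 2 [\<leftarrow>] NHalf cur) t (b - 1)
    (\<lambda>u b'. (only_changes {NAux m, NAux 2} t u \<and> nmem u (NAux 2) 0 = i div 2 \<and>
      (\<forall>j. j \<noteq> i \<longrightarrow> nmem u (NAux m) j = nmem t (NAux m) j) \<and> games_ok m N (i div 2) u) \<and>
      b - 1 \<le> b' + 3)"
    using 3(1) i b assms(3) by (intro runs_frame runs_play) (auto simp: i_def)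
  then show ?case
    by (rule runs_mono) (use 3(1) i b only_changes_trans in auto)
qed auto

lemma only_changes_mono: "only_changes X s t \<Longrightarrow> X \<subseteq> Y \<Longrightarrow> only_changes Y s t"
  by (auto simp: only_changes_def)

text \<open>Insertion and removal differ only in the new leaf entry, the slot itself or 0, and share
  this proof. The condition \<open>m < 2\<close> separates the tree array from the cursor
  \<open>NAux 2\<close>. Two assignments precede the climb, which gives the 3.\<close>

lemma runs_set_leaf:
  assumes "is_tree m s A" "A \<subseteq> Collect (is_breakpoint (nmem s VN 0))"
    and "is_breakpoint (nmem s VN 0) (bp_arg s)" "m < 2"
    and e: "B = insert (bp_arg s) A \<and> e = slot_e \<or> B = A - {bp_arg s} \<and> e = NNum 0"
  shows "runs (set_leaf m e) s (4 * floorlog 2 (cap s) + 3)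
    (\<lambda>t _. only_changes {NAux m, NAux 2} s t \<and> is_tree m t B)"
proof -
  define N where "N = cap s"
  define q where "q = slot (bp_arg s)"
  define z where "z = nval e s"
  define t where "t = nupd (NAux 2) 0 ((N + q) div 2) (nupd (NAux m) (N + q) z s)"
  have q: "q < N" using slot_decode(4)[OF assms(3)] by (simp add: q_def N_def)
  have q_eq: "q = nval slot_e s" by (simp add: q_def slot_def bp_arg_def)
  have i: "(N + q) div 2 < N" using q by simp
  have old: "\<forall>q<N. nmem s (NAux m) (N + q) = (if q \<in> slot ` A then q else 0)"
    using assms(1) by (simp add: is_tree_def tournament_def N_def)
  have games: "games_ok m N ((N + q) div 2) t"
    unfolding games_ok_def
  proof (intro allI impI)
    fix x assume x: "1 \<le> x" "x < N" "x \<noteq> (N + q) div 2"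
    then have "2 * x \<noteq> N + q" "2 * x + 1 \<noteq> N + q" "x \<noteq> N + q" by auto
    moreover have "nmem s (NAux m) x =
        winner m (rmem s (RAux 0)) (nmem s (NAux m) (2 * x)) (nmem s (NAux m) (2 * x + 1))"
      using assms(1) x unfolding is_tree_def tournament_def N_def by blast
    ultimately show "nmem t (NAux m) x =
        winner m (rmem t (RAux 0)) (nmem t (NAux m) (2 * x)) (nmem t (NAux m) (2 * x + 1))"
      using assms(4) by (simp add: t_def)
  qed
  have leaf: "(if x = q then z else if x \<in> slot ` A then x else 0) =
      (if x \<in> slot ` B then x else 0)" for x
    using e
  proof (elim disjE conjE)
    assume "B = insert (bp_arg s) A" "e = slot_e"
    then show ?thesis using q_eq by (simp add: z_def q_def[symmetric])
  next
    assume B: "B = A - {bp_arg s}" and "e = NNum 0"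
    \<comment> \<open>Injectivity of \<open>slot\<close> on valid breakpoints is what prevents
      another member of \<open>A\<close> from sharing the leaf that is cleared.\<close>
    have "slot ` B = slot ` A - {q}"
      unfolding B q_def using assms(2,3)
        inj_on_image_set_diff[OF slot_inj_on[of "nmem s VN 0"], of A "{bp_arg s}"] by auto
    with \<open>e = NNum 0\<close> show ?thesis by (simp add: z_def)
  qed
  have "runs (climb m) t (4 * floorlog 2 ((N + q) div 2) + 1)
    (\<lambda>u _. only_changes {NAux m, NAux 2} t u \<and>
      games_ok m N 0 u \<and> (\<forall>i\<ge>N. nmem u (NAux m) i = nmem t (NAux m) i))"
    using runs_climb[of m N t] games i assms(4) by (simp add: t_def)
  moreover have "floorlog 2 ((N + q) div 2) \<le> floorlog 2 N"
    using i by (intro floorlog_mono) auto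
  ultimately have "runs (climb m) t (4 * floorlog 2 N + 1)
    (\<lambda>u b. (only_changes {NAux m, NAux 2} t u \<and>
      games_ok m N 0 u \<and> (\<forall>i\<ge>N. nmem u (NAux m) i = nmem t (NAux m) i)) \<and>
      4 * floorlog 2 N + 1 \<le> b + (4 * floorlog 2 ((N + q) div 2) + 1))"
    by (intro runs_frame) auto
  then have "runs (climb m) t (4 * floorlog 2 N + 1)
      (\<lambda>t _. only_changes {NAux m, NAux 2} s t \<and> is_tree m t B)"
  proof (rule runs_mono, goal_cases)
    case (1 u b)
    have "nmem u (NAux m) (N + x) = (if x \<in> slot ` B then x else 0)" if "x < N" for x
      using 1 old that assms(4) leaf[of x] by (auto simp: t_def)
    moreover have "only_changes {NAux m, NAux 2} s u"
      using 1 by (auto simp: only_changes_def t_def)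
    moreover have "cap u = N" using 1 by (simp add: only_changes_def t_def N_def)
    ultimately show ?case using 1 unfolding is_tree_def tournament_def games_ok_def by simp
  qed
  moreover define t1 where "t1 = nupd (NAux m) (N + q) z s"
  have "nval leaf_e s = N + q" "nval leaf_e t1 = N + q"
    by (simp_all add: N_def q_eq t1_def)
  moreover have "t = nupd (NAux 2) 0 ((N + q) div 2) t1"
    by (simp add: t_def t1_def)
  ultimately show ?thesis
    unfolding set_leaf_def N_def[symmetric]
    by (simp only: runs_Seq runs_NAssign nval.simps(1,5) z_def[symmetric] t1_def[symmetric]) simp
qed

lemma is_tree_only_changes:
  assumes "only_changes X s t" "VN \<notin> X" "NAux m \<notin> X"
  shows "is_tree m t A \<longleftrightarrow> is_tree m s A"
  using assms by (simp add: is_tree_def only_changes_def)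

text \<open>The cost of the most expensive routine, \<open>tree_add\<close>: four leaf updates at
  \<open>4 * floorlog 2 (4 * n + 4) + 3\<close> steps each and one write to the key table.\<close>

definition tree_time :: "nat \<Rightarrow> nat" where
  "tree_time n = 16 * floorlog 2 (4 * n + 4) + 13"

lemma rep_bp: "rep s M \<Longrightarrow> dom M \<subseteq> Collect (is_breakpoint (nmem s VN 0))"
  by (simp add: rep_def)

lemma rep_key: "rep s M \<Longrightarrow> M p = Some x \<Longrightarrow> rmem s (RAux 0) (slot p) = x"
  unfolding rep_def by blast

lemma unchanged_except_only_changes:
  "only_changes (range NAux) s t \<Longrightarrow> unchanged_except {} {} s t"
  by (simp add: only_changes_def unchanged_except_def)

lemma runs_set_leaves:
  assumes "is_tree 0 s A" "is_tree 1 s A" "A \<subseteq> Collect (is_breakpoint (nmem s VN 0))"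
    and "is_breakpoint (nmem s VN 0) (bp_arg s)"
    and e: "B = insert (bp_arg s) A \<and> e = slot_e \<or> B = A - {bp_arg s} \<and> e = NNum 0"
  shows "runs (set_leaf 0 e ;; set_leaf 1 e) s (8 * floorlog 2 (cap s) + 6)
    (\<lambda>t _. only_changes (range NAux) s t \<and> is_tree 0 t B \<and> is_tree 1 t B)"
  unfolding runs_Seq
proof (rule runs_mono)
  show "runs (set_leaf 0 e) s (8 * floorlog 2 (cap s) + 6)
    (\<lambda>t b. (only_changes {NAux 0, NAux 2} s t \<and> is_tree 0 t B) \<and>
      8 * floorlog 2 (cap s) + 6 \<le> b + (4 * floorlog 2 (cap s) + 3))"
    using assms by (intro runs_frame runs_set_leaf) auto
next
  fix t b
  assume t: "(only_changes {NAux 0, NAux 2} s t \<and> is_tree 0 t B) \<and>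
      8 * floorlog 2 (cap s) + 6 \<le> b + (4 * floorlog 2 (cap s) + 3)"
  then have eq: "nmem t VN = nmem s VN" "bp_arg t = bp_arg s" "is_tree 1 t A"
    using assms(2) is_tree_only_changes[of "{NAux 0, NAux 2}" s t 1 A]
      by (auto simp: only_changes_def bp_arg_def)
  have "runs (set_leaf 1 e) t b (\<lambda>u b'. (only_changes {NAux 1, NAux 2} t u \<and> is_tree 1 u B) \<and>
      b \<le> b' + (4 * floorlog 2 (cap t) + 3))"
    using assms(3-) t eq by (intro runs_frame runs_set_leaf[where A = A]) auto
  then show "runs (set_leaf 1 e) t b (\<lambda>u b'. only_changes (range NAux) s u \<and> is_tree 0 u B \<and>
    is_tree 1 u B)"
  proof (rule runs_mono, goal_cases)
    case (1 u b')
    then have "is_tree 0 u B" using t is_tree_only_changes[of "{NAux 1, NAux 2}" t u 0 B] by auto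
    moreover have "only_changes (range NAux) t u" "only_changes (range NAux) s t"
      using 1 t by (auto elim!: only_changes_mono)
    ultimately show ?case using 1 only_changes_trans by blast
  qed
qed

lemma runs_tree_remove:
  assumes "rep s M" "is_breakpoint (nmem s VN 0) (bp_arg s)"
  shows "runs tree_remove s (8 * floorlog 2 (cap s) + 6)
    (\<lambda>t _. only_changes (range NAux) s t \<and> rep t (M(bp_arg s := None)))"
  unfolding tree_remove_def
proof (rule runs_mono, rule runs_set_leaves)
  show "dom M - {bp_arg s} = insert (bp_arg s) (dom M) \<and> NNum 0 = slot_e \<or>
      dom M - {bp_arg s} = dom M - {bp_arg s} \<and> NNum 0 = NNum 0"
    by simp
next
  fix t b
  assume "only_changes (range NAux) s t \<and> is_tree 0 t (dom M - {bp_arg s}) \<and>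
    is_tree 1 t (dom M - {bp_arg s})"
  moreover from this have "nmem t VN = nmem s VN" by (auto simp: only_changes_def)
  moreover have "dom (M(bp_arg s := None)) = dom M - {bp_arg s}" by simp
  ultimately show "only_changes (range NAux) s t \<and> rep t (M(bp_arg s := None))"
    using assms unfolding rep_def by (auto simp: only_changes_def split: if_splits)
qed (use assms in \<open>auto simp: rep_def\<close>)

lemma runs_tree_add:
  assumes "rep s M" "is_breakpoint (nmem s VN 0) (bp_arg s)"
  shows "runs tree_add s (16 * floorlog 2 (cap s) + 13)
    (\<lambda>t _. unchanged_except {} {} s t \<and> rep t (M(bp_arg s \<mapsto> rmem s ArgKey 0)))"
  unfolding tree_add_def runs_Seq[of tree_remove]
proof (rule runs_mono)
  show "runs tree_remove s (16 * floorlog 2 (cap s) + 13)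
    (\<lambda>t b. (only_changes (range NAux) s t \<and> rep t (M(bp_arg s := None))) \<and>
      16 * floorlog 2 (cap s) + 13 \<le> b + (8 * floorlog 2 (cap s) + 6))"
    using assms by (intro runs_frame runs_tree_remove) auto
next
  fix t b
  define p where "p = bp_arg s"
  define A where "A = dom M - {p}"
  define B where "B = dom (M(p \<mapsto> rmem s ArgKey 0))"
  assume t: "(only_changes (range NAux) s t \<and> rep t (M(bp_arg s := None))) \<and>
      16 * floorlog 2 (cap s) + 13 \<le> b + (8 * floorlog 2 (cap s) + 6)"
  define u where "u = rupd (RAux 0) (slot p) (rmem s ArgKey 0) t"
  have "nmem u VN = nmem s VN" using t by (auto simp: u_def only_changes_def)
  then have bp: "A \<subseteq> Collect (is_breakpoint (nmem u VN 0))" "is_breakpoint (nmem u VN 0) p"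
    using assms rep_bp[OF assms(1)] by (auto simp: A_def p_def)
  have "nmem t ArgIdx = nmem s ArgIdx" "nmem t ArgSet = nmem s ArgSet"
    using t by (auto simp: only_changes_def)
  then have args: "bp_arg u = p" "nval slot_e t = slot p" "cap u = cap s" "rmem t = rmem s"
    using t by (auto simp: p_def u_def only_changes_def bp_arg_def slot_def)
  have new: "slot p \<noteq> slot r" if "r \<in> A" for r
    using inj_onD[OF slot_inj_on[of "nmem u VN 0"], of p r] bp that by (auto simp: A_def)
  \<comment> \<open>At this point slot \<open>p\<close> is in neither tree, so writing its key
    disturbs no game.\<close>
  have "is_tree m u A" if "is_tree m t A" for m
  proof -
    have "tournament (cap t) m ((rmem t (RAux 0))(slot p := rmem s ArgKey 0)) (slot ` A)
        (nmem t (NAux m))"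
      using new by (intro tournament_cong_key[OF that[unfolded is_tree_def]])
        (metis fun_upd_other imageE)
    then show ?thesis by (simp add: is_tree_def u_def)
  qed
  moreover have "dom (M(p := None)) = A" by (simp add: A_def)
  ultimately have trees: "is_tree 0 u A" "is_tree 1 u A"
    using t unfolding rep_def p_def[symmetric] by metis+
  have "runs (set_leaf 0 slot_e ;; set_leaf 1 slot_e) u (b - 1) (\<lambda>v b'.
      (only_changes (range NAux) u v \<and> is_tree 0 v B \<and> is_tree 1 v B) \<and>
      b - 1 \<le> b' + (8 * floorlog 2 (cap u) + 6))"
    by (intro runs_frame runs_set_leaves[of u A B])
      (use trees bp args t in \<open>auto simp: A_def B_def\<close>)
  then have "runs (set_leaf 0 slot_e ;; set_leaf 1 slot_e) u (b - 1)
     (\<lambda>v b'. unchanged_except {} {} s v \<and> rep v (M(p \<mapsto> rmem s ArgKey 0)))"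
  proof (rule runs_mono, goal_cases)
    case (1 v b')
    have "unchanged_except {} {} s v"
      using 1 t by (auto simp: unchanged_except_def only_changes_def u_def)
    moreover have "nmem v VN = nmem u VN" using 1 by (auto simp: only_changes_def)
    then have "B \<subseteq> Collect (is_breakpoint (nmem v VN 0))"
      using bp by (auto simp: A_def B_def)
    moreover have "rmem v (RAux 0) (slot r) = x" if "(M(p \<mapsto> rmem s ArgKey 0)) r = Some x" for r x
    proof (cases "r = p")
      case True
      then show ?thesis using 1 that by (simp add: only_changes_def u_def)
    next
      case False
      then have "r \<in> A" using that by (auto simp: A_def)
      then have "rmem v (RAux 0) (slot r) = rmem s (RAux 0) (slot r)"
        using 1 new[THEN not_sym] args by (simp add: only_changes_def u_def)
      then show ?thesis using rep_key[OF assms(1)] that False by simp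
    qed
    ultimately show ?case using 1 by (simp add: rep_def B_def)
  qed
  moreover have "1 \<le> b" using t by linarith
  ultimately show "runs (RAssign (RAux 0) slot_e (RAt ArgKey (NNum 0)) ;;
      set_leaf 0 slot_e ;; set_leaf 1 slot_e) t b
      (\<lambda>t _. unchanged_except {} {} s t \<and> rep t (M(bp_arg s \<mapsto> rmem s ArgKey 0)))"
    using args by (simp only: runs_Seq[of "RAssign _ _ _"] runs_RAssign rval.simps nval.simps(1)
      u_def p_def[symmetric])
qed

text \<open>Everything is read off the root: it is 0 exactly if no breakpoint is present, and
  otherwise it is an occupied slot that precedes all others. One test and four assignments make 5
  steps.\<close>

lemma runs_tree_query:
  assumes "rep s M" "m < 2"
  shows "runs (tree_query m) s 5 (\<lambda>t _. unchanged_except {Found, ResSet, ResIdx} {Delta} s t \<and>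
    rep t M \<and>
    (if M = Map.empty then nmem t Found 0 = 0
     else nmem t Found 0 = 1 \<and> M (bp_answer t) = Some (rmem t Delta 0) \<and>
       (\<forall>y \<in> ran M. precedes m (rmem t Delta 0) y)))"
proof -
  define w where "w = nmem s (NAux m) 1"
  have tree: "tournament (cap s) m (rmem s (RAux 0)) (slot ` dom M) (nmem s (NAux m))"
    using assms by (auto simp: rep_def is_tree_def less_2_cases_iff)
  have bp: "is_breakpoint (nmem s VN 0) p" if "M p = Some x" for p x
    using rep_bp[OF assms(1)] that by blast
  have occ: "\<exists>p x. M p = Some x \<and> w = slot p \<and> w \<noteq> 0 \<and> w div 2 div 2 = snd p \<and>
      w - 4 * snd p = fst p \<and> rmem s (RAux 0) w = x" if "w \<noteq> 0"
  proof -
    from tournament_entry[OF tree, of 1] that have "w \<in> slot ` dom M" by (simp add: w_def)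
    then obtain p x where "M p = Some x" "w = slot p" by auto
    moreover have "is_breakpoint (nmem s VN 0) p"
      using bp \<open>M p = Some x\<close> by blast
    moreover have "rmem s (RAux 0) (slot p) = x"
      using rep_key[OF assms(1) \<open>M p = Some x\<close>] .
    ultimately show ?thesis
      using slot_decode by (intro exI[of _ p] exI[of _ x]) simp
  qed
  have first: "w \<noteq> 0 \<and> precedes m (rmem s (RAux 0) w) x" if "M p = Some x" for p x
  proof -
    have "w \<noteq> 0 \<and> precedes m (rmem s (RAux 0) w) (rmem s (RAux 0) (slot p))"
      unfolding w_def using that slot_decode(3,4)[OF bp[OF that]]
      by (intro tournament_leaf_precedes[OF tree]) auto
    then show ?thesis using rep_key[OF assms(1) that] by simp
  qed
  have rep: "rep t M" if "nmem t VN = nmem s VN" "rmem t (RAux 0) = rmem s (RAux 0)"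
    "\<And>m. nmem t (NAux m) = nmem s (NAux m)" for t
    using assms(1) that by (simp add: rep_def is_tree_def)
  show ?thesis
  proof (cases "w = 0")
    case True
    then have "M = Map.empty" using first by fastforce
    then show ?thesis
      using True rep by (simp add: tree_query_def Let_def w_def unchanged_except_def)
  next
    case False
    from occ[OF this] obtain p x where p: "M p = Some x" "w = slot p" "w \<noteq> 0"
      "w div 2 div 2 = snd p" "w - 4 * snd p = fst p" "rmem s (RAux 0) w = x"
      by blast
    then have "M \<noteq> Map.empty" by auto
    moreover have "precedes m x y" if "y \<in> ran M" for y
      using first that p by (auto simp: ran_def)
    moreover have "w - (snd p + snd p + snd p + snd p) = fst p" using p(5) by simp
    ultimately show ?thesis
      using p rep by (simp add: tree_query_def Let_def w_def[symmetric, unfolded One_nat_def]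
        unchanged_except_def bp_answer_def)
  qed
qed

text \<open>All-zero arrays form a tournament without participants, since two zero children produce
  0. There are \<open>8 * n + 8\<close> entries at four steps each, and three further steps for the
  two initial assignments and the last test.\<close>

lemma runs_tree_init:
  "runs tree_init s (32 * nmem s VN 0 + 35) (\<lambda>t _. unchanged_except {} {} s t \<and> rep t Map.empty)"
proof -
  define N where "N = cap s"
  have rep: "rep t Map.empty" if "nmem t VN = nmem s VN"
    and "\<And>m i. m < 2 \<Longrightarrow> i < 2 * N \<Longrightarrow> nmem t (NAux m) i = 0" for t
    using that by (auto simp: rep_def is_tree_def tournament_def winner_def N_def)
  define u where "u = nupd (NAux 2) 0 (2 * N) (nupd (NAux 2) 0 N s)"
  have "runs (WHILE NNum 0 [<] cur DO
      (NAux 2 [\<leftarrow>] cur [-] NNum 1 ;; NAssign (NAux 0) cur (NNum 0) ;; NAssign (NAux 1) cur (NNum 0)))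
      u (32 * nmem s VN 0 + 33) (\<lambda>t _. unchanged_except {} {} s t \<and> rep t Map.empty)"
  proof (rule runs_While[where Inv = "\<lambda>t b. only_changes (range NAux) s t \<and>
    4 * nmem t (NAux 2) 0 + 1 \<le> b \<and>
      (\<forall>m i. m < 2 \<longrightarrow> nmem t (NAux 2) 0 \<le> i \<longrightarrow> i < 2 * N \<longrightarrow> nmem t (NAux m) i = 0)"], goal_cases)
    case 1
    then show ?case by (auto simp: u_def only_changes_def N_def)
  next
    case (3 t b)
    have "i \<noteq> nmem t (NAux 2) 0 - 1 \<Longrightarrow> nmem t (NAux 2) 0 - 1 \<le> i \<Longrightarrow> nmem t (NAux 2) 0 \<le> i" for i
      by simp
    then show ?case using 3 by (auto simp: only_changes_def less_2_cases_iff)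
  next
    case (4 t b)
    then have "nmem t VN = nmem s VN" by (auto simp: only_changes_def)
    then show ?case using 4 unchanged_except_only_changes by (auto intro!: rep)
  qed auto
  moreover define t1 where "t1 = nupd (NAux 2) 0 N s"
  have "nval (nn [+] nn [+] nn [+] nn [+] NNum 4) s = N" "nval (cur [+] cur) t1 = 2 * N"
    by (simp_all add: N_def t1_def)
  moreover have "u = nupd (NAux 2) 0 (2 * N) t1"
    by (simp add: u_def t1_def)
  moreover have "32 * nmem s VN 0 + 35 - 1 - 1 = 32 * nmem s VN 0 + 33" by simp
  ultimately show ?thesis
    unfolding tree_init_def
    by (simp only: runs_Seq[of "NAssign _ _ _"] runs_NAssign nval.simps(1) t1_def[symmetric]) simp
qed

lemmas tree_program_defs =
  tree_init_def tree_remove_def tree_add_def tree_query_def set_leaf_def climb_def play_def Let_def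

lemma represents_trees: "represents_breakpoints trees rep"
  unfolding represents_breakpoints_def trees_def bp_impl.simps
proof (intro conjI allI impI, goal_cases)
  case (1 s t M)
  then show ?case by (simp add: rep_def is_tree_def same_workspace_def)
next
  case (2 s)
  then show ?case
    by (rule runs_abort_free[OF runs_tree_init]) (simp add: tree_program_defs)
next
  case (3 s M)
  then show ?case
    by (rule runs_abort_free[OF runs_tree_add]) (simp add: tree_program_defs)
next
  case (4 s M)
  from runs_abort_free[OF runs_tree_remove[OF this]] show ?case
    using unchanged_except_only_changes by (auto simp: tree_program_defs)
next
  case (5 s M)
  have "\<exists>k t. exec (tree_query 0) s k (Done t) \<and>
    unchanged_except {Found, ResSet, ResIdx} {Delta} s t \<and> rep t M \<and>
    (if M = Map.empty then nmem t Found 0 = 0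
     else nmem t Found 0 = 1 \<and> M (bp_answer t) = Some (rmem t Delta 0) \<and>
       (\<forall>y \<in> ran M. precedes 0 (rmem t Delta 0) y))"
    using 5 by (intro runs_abort_free[OF runs_tree_query]) (simp_all add: tree_program_defs)
  then show ?case by (simp only: is_minimum_def precedes_def simp_thms if_True)
next
  case (6 s M)
  have "\<exists>k t. exec (tree_query 1) s k (Done t) \<and>
    unchanged_except {Found, ResSet, ResIdx} {Delta} s t \<and> rep t M \<and>
    (if M = Map.empty then nmem t Found 0 = 0
     else nmem t Found 0 = 1 \<and> M (bp_answer t) = Some (rmem t Delta 0) \<and>
       (\<forall>y \<in> ran M. precedes 1 (rmem t Delta 0) y))"
    using 6 by (intro runs_abort_free[OF runs_tree_query]) (simp_all add: tree_program_defs)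
  then show ?case by (simp only: is_maximum_def precedes_def one_neq_zero if_False)
qed

section \<open>Amortized cost of the algorithm\<close>

text \<open>Every breakpoint present holds a credit of \<open>C\<close> steps, which pays for the iteration that
  removes it.\<close>

definition avail :: "nat \<Rightarrow> (state \<Rightarrow> breakpoints \<Rightarrow> bool) \<Rightarrow> nat \<Rightarrow> state \<Rightarrow> nat \<Rightarrow> bool" where
  "avail C R e s b \<longleftrightarrow> (\<exists>M. R s M \<and> e + C * card (dom M) \<le> b)"

text \<open>\<open>e\<close> is budget set aside for whatever follows. Quantifying over it makes
  these triples compose sequentially; \<open>B\<close> is the amortized cost in addition to the
  credits.\<close>

definition amort :: "nat \<Rightarrow> (state \<Rightarrow> breakpoints \<Rightarrow> bool) \<Rightarrow> com \<Rightarrow> nat \<Rightarrow>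
    (state \<Rightarrow> breakpoints \<Rightarrow> bool) \<Rightarrow> bool" where
  "amort C R c B R' \<longleftrightarrow> (\<forall>e s b. avail C R (e + B) s b \<longrightarrow> runs c s b (avail C R' e))"

lemma amortI:
  assumes "\<And>e s b M. R s M \<Longrightarrow> e + B + C * card (dom M) \<le> b \<Longrightarrow> runs c s b (avail C R' e)"
  shows "amort C R c B R'"
  using assms by (auto simp: amort_def avail_def)

lemma amortD:
  assumes "amort C R c B R'" "R s M" "e + B + C * card (dom M) \<le> b"
  shows "runs c s b (avail C R' e)"
  using assms unfolding amort_def avail_def by blast

lemma amort_mono: "amort C R c B R' \<Longrightarrow> B \<le> B' \<Longrightarrow> amort C R c B' R'"
  by (rule amortI, erule amortD) auto

lemma amort_Seq:
  assumes "amort C R c B R1" "amort C R1 d B' R2"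
  shows "amort C R (c ;; d) (B + B') R2"
proof (rule amortI)
  fix e s b M assume "R s M" "e + (B + B') + C * card (dom M) \<le> b"
  then have "runs c s b (avail C R1 (e + B'))"
    by (intro amortD[OF assms(1)]) (auto simp: ac_simps)
  then show "runs (c ;; d) s b (avail C R2 e)"
    using assms(2) by (auto simp: amort_def elim: runs_mono)
qed

text \<open>Both branches are charged. This loses only a constant factor for a fixed program and
  keeps bounds plain sums that the rules can assemble.\<close>

lemma amort_Cond:
  assumes "amort C R c B R'" "amort C R d B' R'"
  shows "amort C R (IF p THEN c ELSE d) (1 + B + B') R'"
proof (rule amortI)
  fix e s b M
  assume *: "R s M" "e + (1 + B + B') + C * card (dom M) \<le> b"
  then have "e + B + C * card (dom M) \<le> b - 1" "e + B' + C * card (dom M) \<le> b - 1"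
    by linarith+
  then have "runs c s (b - 1) (avail C R' e)" "runs d s (b - 1) (avail C R' e)"
    using amortD[OF assms(1) *(1)] amortD[OF assms(2) *(1)] by blast+
  with *(2) show "runs (IF p THEN c ELSE d) s b (avail C R' e)" by simp
qed

lemma amort_Skip: "amort C R Skip 1 R"
  by (auto simp: amort_def avail_def)

section \<open>Invariants of the algorithm and the cost of its basic operations\<close>

definition workspace_stable :: "(state \<Rightarrow> breakpoints \<Rightarrow> bool) \<Rightarrow> bool" where
  "workspace_stable \<rho> \<longleftrightarrow> (\<forall>s t M. \<rho> s M \<longrightarrow> same_workspace s t \<longrightarrow> nmem s VN 0 = nmem t VN 0 \<longrightarrow> \<rho> t M)"

definition keeps :: "(state \<Rightarrow> breakpoints \<Rightarrow> bool) \<Rightarrow> nat \<Rightarrow> nvar \<Rightarrow> nat \<Rightarrow> state \<Rightarrow> breakpoints \<Rightarrow> bool"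
  where "keeps \<rho> n v x s M \<longleftrightarrow> \<rho> s M \<and> nmem s VN 0 = n \<and> nmem s v 0 = x"

lemma stable_rep: "workspace_stable rep"
  unfolding workspace_stable_def
  by (intro allI impI) (simp add: rep_def is_tree_def same_workspace_def)

lemma stable_empty: "workspace_stable (\<lambda>s M. M = Map.empty)"
  by (simp add: workspace_stable_def)

lemma stableD:
  "workspace_stable \<rho> \<Longrightarrow> \<rho> s M \<Longrightarrow> same_workspace s t \<Longrightarrow> nmem s VN 0 = nmem t VN 0 \<Longrightarrow> \<rho> t M"
  unfolding workspace_stable_def by blast

lemma stable_nupd: "workspace_stable \<rho> \<Longrightarrow> \<rho> s M \<Longrightarrow> w \<notin> range NAux \<Longrightarrow> w \<noteq> VN \<Longrightarrow> \<rho> (nupd w i y s) M"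
  by (erule stableD) (auto simp: same_workspace_def)

lemma stable_rupd: "workspace_stable \<rho> \<Longrightarrow> \<rho> s M \<Longrightarrow> w \<notin> range RAux \<Longrightarrow> \<rho> (rupd w i y s) M"
  by (erule stableD) (auto simp: same_workspace_def)

lemmas rep_nupd = stable_nupd[OF stable_rep]
lemmas rep_rupd = stable_rupd[OF stable_rep]

lemma amort_NAssign:
  assumes "workspace_stable \<rho>" "w \<notin> range NAux" "w \<noteq> VN" "w \<noteq> v"
  shows "amort C (keeps \<rho> n v x) (NAssign w e f) 1 (keeps \<rho> n v x)"
proof (rule amortI)
  fix a s b M
  assume "keeps \<rho> n v x s M" "a + 1 + C * card (dom M) \<le> b"
  moreover from this have "keeps \<rho> n v x (nupd w (nval e s) (nval f s) s) M"
    using assms by (simp add: keeps_def stable_nupd)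
  ultimately show "runs (NAssign w e f) s b (avail C (keeps \<rho> n v x) a)"
    by (auto simp: avail_def)
qed

lemma amort_RAssign:
  assumes "workspace_stable \<rho>" "w \<notin> range RAux"
  shows "amort C (keeps \<rho> n v x) (RAssign w e f) 1 (keeps \<rho> n v x)"
proof (rule amortI)
  fix a s b M
  assume "keeps \<rho> n v x s M" "a + 1 + C * card (dom M) \<le> b"
  moreover from this have "keeps \<rho> n v x (rupd w (nval e s) (rval f s) s) M"
    using assms by (simp add: keeps_def stable_rupd)
  ultimately show "runs (RAssign w e f) s b (avail C (keeps \<rho> n v x) a)"
    by (auto simp: avail_def)
qed

lemma runs_bp_add:
  assumes "rep s M" "is_breakpoint (nmem s VN 0) (bp_arg s)" "tree_time (nmem s VN 0) \<le> b"
  shows "runs (bp_add trees) s b (\<lambda>t b'. (unchanged_except {} {} s t \<and>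
    rep t (M(bp_arg s \<mapsto> rmem s ArgKey 0))) \<and> b \<le> b' + tree_time (nmem s VN 0))"
  using runs_frame[OF runs_tree_add[OF assms(1,2)]] assms(3) by (simp add: trees_def tree_time_def)

lemma runs_bp_remove:
  assumes "rep s M" "is_breakpoint (nmem s VN 0) (bp_arg s)" "tree_time (nmem s VN 0) \<le> b"
  shows "runs (bp_remove trees) s b (\<lambda>t b'. (unchanged_except {} {} s t \<and>
    rep t (M(bp_arg s := None))) \<and> b \<le> b' + tree_time (nmem s VN 0))"
proof -
  have "runs tree_remove s b (\<lambda>t b'. (only_changes (range NAux) s t \<and> rep t (M(bp_arg s := None))) \<and>
      b \<le> b' + (8 * floorlog 2 (cap s) + 6))"
    using assms by (intro runs_frame runs_tree_remove) (auto simp: tree_time_def)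
  then show ?thesis
    unfolding trees_def bp_impl.simps
    by (rule runs_mono) (auto simp: tree_time_def intro: unchanged_except_only_changes)
qed

lemma keeps_unchanged:
  assumes "unchanged_except X Y s t" "v \<notin> range NAux \<union> X" "VN \<notin> X" "nmem s VN 0 = n"
    "nmem s v 0 = x" "rep t M"
  shows "keeps rep n v x t M"
  using assms unfolding keeps_def unchanged_except_def by auto

text \<open>The summand \<open>C\<close> pays the credit of the new breakpoint; 3 counts the
  argument assignments. The premise \<open>is_breakpoint 1 (S, 1)\<close> just says that
  \<open>S\<close> is one of the four set tags.\<close>

lemma amort_add_bp:
  assumes "is_breakpoint 1 (S, 1)" "v \<notin> range NAux" "v \<noteq> ArgSet" "v \<noteq> ArgIdx"
    and i: "\<And>s. nmem s VN 0 = n \<Longrightarrow> nmem s v 0 = x \<Longrightarrow> 1 \<le> nval i s \<and> nval i s \<le> n"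
  shows "amort C (keeps rep n v x) (add_bp trees S i e) (3 + tree_time n + C) (keeps rep n v x)"
proof (rule amortI)
  fix a s b M
  assume s: "keeps rep n v x s M" and b: "a + (3 + tree_time n + C) + C * card (dom M) \<le> b"
  define s' where "s' = nupd ArgSet 0 S s"
  define t where "t =
    rupd ArgKey 0 (rval e (nupd ArgIdx 0 (nval i s') s')) (nupd ArgIdx 0 (nval i s') s')"
  have "rep s' M"
    using s unfolding s'_def by (intro rep_nupd) (auto simp: keeps_def)
  then have "rep t M"
    unfolding t_def by (intro rep_nupd rep_rupd) auto
  moreover have t: "nmem t VN 0 = n" "nmem t v 0 = x" "bp_arg t = (S, nval i s')"
    using s assms(3,4) by (auto simp: t_def s'_def keeps_def bp_arg_def)
  moreover have "is_breakpoint n (bp_arg t)"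
    using assms(1,3) i[of s'] s t by (auto simp: is_breakpoint_iff s'_def keeps_def)
  ultimately have "runs (bp_add trees) t (b - 3) (\<lambda>u b'. (unchanged_except {} {} t u \<and>
    rep u (M(bp_arg t \<mapsto> rmem t ArgKey 0))) \<and> b - 3 \<le> b' + tree_time n)"
    using runs_bp_add[of t M "b - 3"] b by simp
  then have "runs (bp_add trees) t (b - 3) (avail C (keeps rep n v x) a)"
  proof (rule runs_mono, goal_cases)
    case (1 u b')
    \<comment> \<open>Only an inequality, since the breakpoint may already be present: a subproblem
      can insert a \<open>\<kappa>^j\<close> that \<open>lower_update\<close> has just
      inserted.\<close>
    have "card (dom (M(bp_arg t \<mapsto> rmem t ArgKey 0))) \<le> Suc (card (dom M))"
      by (cases "finite (dom M)") (simp_all add: card_insert_if)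
    then have "C * card (dom (M(bp_arg t \<mapsto> rmem t ArgKey 0))) \<le> C * Suc (card (dom M))"
      by (rule mult_le_mono2)
    then show ?case
      unfolding avail_def using 1 b t assms(2)
      by (intro exI[of _ "M(bp_arg t \<mapsto> rmem t ArgKey 0)"] conjI keeps_unchanged[where s = t
        and X = "{}" and Y = "{}"]) auto
  qed
  then show "runs (add_bp trees S i e) s b (avail C (keeps rep n v x) a)"
    using b by (simp add: add_bp_def t_def s'_def numeral_3_eq_3, intro conjI; linarith)
qed

lemma runs_remove_bp:
  assumes "keeps rep n v x s M" "is_breakpoint 1 (S, 1)" "v \<notin> range NAux" "v \<noteq> ArgSet" "v \<noteq> ArgIdx"
    and k: "nval i (nupd ArgSet 0 S s) = k" "1 \<le> k" "k \<le> n"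
    and b: "a + (2 + tree_time n) + C * card (dom (M((S, k) := None))) \<le> b"
  shows "runs (remove_bp trees S i) s b (avail C (keeps rep n v x) a)"
proof -
  define t where "t = nupd ArgIdx 0 k (nupd ArgSet 0 S s)"
  have "rep t M"
    unfolding t_def using assms(1) by (intro rep_nupd) (auto simp: keeps_def)
  moreover have t: "nmem t VN 0 = n" "nmem t v 0 = x" "bp_arg t = (S, k)"
    using assms by (auto simp: t_def keeps_def bp_arg_def)
  moreover have "is_breakpoint n (bp_arg t)"
    using assms(2) k t by (auto simp: is_breakpoint_iff)
  ultimately have "runs (bp_remove trees) t (b - 2) (\<lambda>u b'. (unchanged_except {} {} t u \<and>
    rep u (M((S, k) := None))) \<and> b - 2 \<le> b' + tree_time n)"
    using runs_bp_remove[of t M "b - 2"] b by simp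
  then have "runs (bp_remove trees) t (b - 2) (avail C (keeps rep n v x) a)"
  proof (rule runs_mono, goal_cases)
    case (1 u b')
    then show ?case
      unfolding avail_def using b t assms(3)
      by (intro exI[of _ "M((S, k) := None)"] conjI keeps_unchanged[where s = t and X = "{}"
        and Y = "{}"]) auto
  qed
  then show ?thesis
    using b k(1) by (simp add: remove_bp_def t_def numeral_2_eq_2)
qed

text \<open>For removals of breakpoints that may be absent, such as \<open>\<kappa>^(j-1)\<close> in
  \<open>lower_update\<close>. No freed credit is claimed, so the full cost is charged.\<close>

lemma amort_remove_bp:
  assumes "is_breakpoint 1 (S, 1)" "v \<notin> range NAux" "v \<noteq> ArgSet" "v \<noteq> ArgIdx"
    and i: "\<And>s. nmem s VN 0 = n \<Longrightarrow> nmem s v 0 = x \<Longrightarrow> 1 \<le> nval i s \<and> nval i s \<le> n"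
  shows "amort C (keeps rep n v x) (remove_bp trees S i) (2 + tree_time n) (keeps rep n v x)"
proof (rule amortI)
  fix a s b M
  assume s: "keeps rep n v x s M" and b: "a + (2 + tree_time n) + C * card (dom M) \<le> b"
  define k where "k = nval i (nupd ArgSet 0 S s)"
  have "card (dom M - {(S, k)}) \<le> card (dom M)"
    using card_Diff1_le .
  then have "C * card (dom (M((S, k) := None))) \<le> C * card (dom M)"
    by (simp add: mult_le_mono2)
  then have "a + (2 + tree_time n) + C * card (dom (M((S, k) := None))) \<le> b"
    using b by linarith
  moreover have "1 \<le> k \<and> k \<le> n"
    unfolding k_def using s assms(3) by (intro i) (auto simp: keeps_def)
  ultimately show "runs (remove_bp trees S i) s b (avail C (keeps rep n v x) a)"
    using assms by (intro runs_remove_bp[OF s, where k = k]) (auto simp: k_def)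
qed

text \<open>There are at most \<open>n + 1\<close> rounds, reached for \<open>l = 0\<close>. Each
  adds a test and an increment to the body; the final 2 is the initial assignment and the failing
  test. The body must leave the counter unchanged, so it is specified for each value
  \<open>x\<close> separately.\<close>

lemma amort_for_up:
  assumes v: "workspace_stable \<rho>" "v \<notin> range NAux" "v \<noteq> VN"
    and body: "\<And>x. l \<le> x \<Longrightarrow> x \<le> n \<Longrightarrow> amort C (keeps \<rho> n v x) c B (keeps \<rho> n v x)"
  shows "amort C (keeps \<rho> n VN n) (for_up v (NNum l) nn c) ((n + 1) * (B + 2) + 2) (keeps \<rho> n VN n)"
proof (rule amortI)
  fix e s b M
  assume s: "keeps \<rho> n VN n s M" and b: "e + ((n + 1) * (B + 2) + 2) + C * card (dom M) \<le> b"
  define Inv where "Inv t b \<longleftrightarrow> l \<le> nmem t v 0 \<and>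
    avail C (keeps \<rho> n VN n) (e + 1 + (n + 1 - nmem t v 0) * (B + 2)) t b" for t b
  have "runs (WHILE BNot (nn [<] NAt v (NNum 0)) DO (c ;; v [\<leftarrow>] NAt v (NNum 0) [+] NNum 1))
    (nupd v 0 l s) (b - 1) (avail C (keeps \<rho> n VN n) e)"
  proof (rule runs_While[where Inv = Inv], goal_cases)
    case 1
    have "(n + 1 - l) * (B + 2) \<le> (n + 1) * (B + 2)" by (rule mult_le_mono1) simp
    moreover have "keeps \<rho> n VN n (nupd v 0 l s) M"
      using s v by (simp add: keeps_def stable_nupd)
    ultimately show ?case using b by (auto simp: Inv_def avail_def intro!: exI[of _ M])
  next
    case (2 t b)
    then show ?case by (auto simp: Inv_def avail_def)
  next
    case (3 t b)
    define x where "x = nmem t v 0"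
    from 3(1) obtain M' where M': "keeps \<rho> n VN n t M'"
      "e + 1 + (n + 1 - x) * (B + 2) + C * card (dom M') \<le> b" "l \<le> x"
      by (auto simp: Inv_def avail_def x_def)
    from M'(1) 3(2) have x: "x \<le> n" by (simp add: keeps_def x_def)
    then have "(n + 1 - x) * (B + 2) = (n + 1 - Suc x) * (B + 2) + B + 2"
      by (simp add: Suc_diff_le)
    with M'(2) have b: "(e + 1 + (n + 1 - Suc x) * (B + 2) + 1) + B + C * card (dom M') \<le> b - 1"
      by linarith
    have "keeps \<rho> n v x t M'" using M'(1) by (simp add: keeps_def x_def)
    from amortD[OF body[OF M'(3) x] this b] show ?case
      unfolding runs_Seq runs_NAssign
    proof (rule runs_mono, goal_cases)
      case (1 u b')
      then obtain M'' where M'': "keeps \<rho> n v x u M''"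
        "(e + 1 + (n + 1 - Suc x) * (B + 2) + 1) + C * card (dom M'') \<le> b'"
        by (auto simp: avail_def)
      then have "nupd v (nval (NNum 0) u) (nval (NAt v (NNum 0) [+] NNum 1) u) u =
          nupd v 0 (Suc x) u"
        by (simp add: keeps_def)
      moreover have "keeps \<rho> n VN n (nupd v 0 (Suc x) u) M''"
        using M''(1) v by (simp add: keeps_def stable_nupd)
      moreover have "e + 1 + (n + 1 - Suc x) * (B + 2) + C * card (dom M'') \<le> b' - 1" "1 \<le> b'"
        using M''(2) by linarith+
      moreover have "nmem (nupd v 0 (Suc x) u) v 0 = Suc x" by simp
      ultimately show ?case
        using M'(3) unfolding Inv_def avail_def by (metis le_SucI)
    qed
  next
    case (4 t b)
    then show ?case by (auto simp: Inv_def avail_def)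
  qed
  then show "runs (for_up v (NNum l) nn c) s b (avail C (keeps \<rho> n VN n) e)"
    using b by (simp add: for_up_def)
qed

lemma amort_for_down:
  assumes v: "workspace_stable \<rho>" "v \<notin> range NAux" "v \<noteq> VN"
    and body: "\<And>x. amort C (keeps \<rho> n v x) c B (keeps \<rho> n v x)"
  shows "amort C (keeps \<rho> n VN n) (for_down v (nn [-] NNum 1) c) ((n + 1) * (B + 2) + 2) (keeps \<rho>
    n VN n)"
proof (rule amortI)
  fix e s b M
  assume s: "keeps \<rho> n VN n s M" and b: "e + ((n + 1) * (B + 2) + 2) + C * card (dom M) \<le> b"
  define Inv where "Inv t b \<longleftrightarrow>
    avail C (keeps \<rho> n VN n) (e + 1 + nmem t v 0 * (B + 2)) t b" for t b
  have "runs (WHILE NNum 0 [<] NAt v (NNum 0) DO (c ;; v [\<leftarrow>] NAt v (NNum 0) [-] NNum 1))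
    (nupd v 0 (n - 1) s) (b - 1) (avail C (keeps \<rho> n VN n) e)"
  proof (rule runs_While[where Inv = Inv], goal_cases)
    case 1
    have "(n - 1) * (B + 2) \<le> (n + 1) * (B + 2)" by (rule mult_le_mono1) simp
    moreover have "keeps \<rho> n VN n (nupd v 0 (n - 1) s) M"
      using s v by (simp add: keeps_def stable_nupd)
    ultimately show ?case using b by (auto simp: Inv_def avail_def intro!: exI[of _ M])
  next
    case (2 t b)
    then show ?case by (auto simp: Inv_def avail_def)
  next
    case (3 t b)
    from 3(2) obtain x where x: "nmem t v 0 = Suc x" by (auto simp: gr0_conv_Suc)
    with 3(1) obtain M' where M': "keeps \<rho> n VN n t M'"
      "e + 1 + Suc x * (B + 2) + C * card (dom M') \<le> b"
      by (auto simp: Inv_def avail_def)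
    from M'(2) have b: "(e + 1 + x * (B + 2) + 1) + B + C * card (dom M') \<le> b - 1"
      unfolding mult_Suc by linarith
    have "keeps \<rho> n v (Suc x) t M'" using M'(1) x by (simp add: keeps_def)
    from amortD[OF body this b] show ?case
      unfolding runs_Seq runs_NAssign
    proof (rule runs_mono, goal_cases)
      case (1 u b')
      then obtain M'' where M'': "keeps \<rho> n v (Suc x) u M''"
        "(e + 1 + x * (B + 2) + 1) + C * card (dom M'') \<le> b'"
        by (auto simp: avail_def)
      then have "nupd v (nval (NNum 0) u) (nval (NAt v (NNum 0) [-] NNum 1) u) u = nupd v 0 x u"
        by (simp add: keeps_def)
      moreover have "keeps \<rho> n VN n (nupd v 0 x u) M''"
        using M''(1) v by (simp add: keeps_def stable_nupd)
      moreover have "e + 1 + x * (B + 2) + C * card (dom M'') \<le> b' - 1" "1 \<le> b'"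
        using M''(2) by linarith+
      moreover have "nmem (nupd v 0 x u) v 0 = x" by simp
      ultimately show ?case
        unfolding Inv_def avail_def by metis
    qed
  next
    case (4 t b)
    then show ?case by (auto simp: Inv_def avail_def)
  qed
  moreover have "nval (nn [-] NNum 1) s = n - 1" using s by (simp add: keeps_def)
  ultimately show "runs (for_down v (nn [-] NNum 1) c) s b (avail C (keeps \<rho> n VN n) e)"
    using b unfolding for_down_def runs_Seq[of "NAssign _ _ _"] runs_NAssign nval.simps(1) by simp
qed

section \<open>The two subproblems\<close>

definition credit :: "nat \<Rightarrow> nat" where
  "credit n = 2 * tree_time n + 30"

lemma runs_tree_query_frame:
  assumes "rep s M" "m < 2" "5 \<le> b"
  shows "runs (tree_query m) s b (\<lambda>t b'. (unchanged_except {Found, ResSet, ResIdx} {Delta} s t \<and>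
    rep t M \<and>
    (if M = Map.empty then nmem t Found 0 = 0
     else nmem t Found 0 = 1 \<and> M (bp_answer t) = Some (rmem t Delta 0) \<and>
       (\<forall>y \<in> ran M. precedes m (rmem t Delta 0) y))) \<and> b \<le> b' + 5)"
  using assms by (intro runs_frame runs_tree_query)

text \<open>Here the breakpoint is known to be present. Its credit \<open>C\<close> is released,
  which is why the available budget appears as \<open>b + C\<close>.\<close>

lemma runs_remove_answer:
  assumes s: "keeps rep n VJ j s M" and p: "M (bp_answer s) = Some y" and S: "nmem s ResSet 0 = S"
    and b: "a + 4 + tree_time n + C * card (dom M) \<le> b + C"
  shows "runs (VP \<leftarrow> e ;; VQ \<leftarrow> f ;; remove_bp trees S kk) s b (avail C (keeps rep n VJ j) a)"
proof -
  define k where "k = nmem s ResIdx 0"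
  have ans: "bp_answer s = (S, k)" using S by (simp add: bp_answer_def k_def)
  have "is_breakpoint n (S, k)"
    using rep_bp[of s M] s p ans by (auto simp: keeps_def)
  \<comment> \<open>Finiteness matters: \<open>card\<close> is 0 on infinite sets, and the removal
    would then free nothing.\<close>
  have "finite (Collect (is_breakpoint n))"
    by (rule finite_subset[of _ "{..<4} \<times> {..n}"]) (auto simp: is_breakpoint_iff)
  then have "finite (dom M)"
    using rep_bp[of s M] s by (auto simp: keeps_def intro: finite_subset)
  moreover have "(S, k) \<in> dom M" using p ans by auto
  ultimately have "card (dom M) = Suc (card (dom M - {(S, k)}))"
    by (rule card.remove)
  then have b': "a + 4 + tree_time n + C * card (dom M - {(S, k)}) \<le> b"
    using b by simp
  define t where "t = rupd VQ 0 (rval f (rupd VP 0 (rval e s) s)) (rupd VP 0 (rval e s) s)"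
  have "keeps rep n VJ j t M"
    using s by (auto simp: t_def keeps_def intro!: rep_rupd)
  then have "runs (remove_bp trees S kk) t (b - 2) (avail C (keeps rep n VJ j) a)"
    using \<open>is_breakpoint n (S, k)\<close> b'
    by (intro runs_remove_bp[where k = k]) (auto simp: is_breakpoint_iff t_def k_def)
  then show ?thesis using b' by (simp add: t_def numeral_2_eq_2)
qed

text \<open>One scheme for both subproblems: the tests on data and the updates of \<open>P\<close>
  and \<open>Q\<close> are arbitrary, because neither affects the cost argument.\<close>

lemma amort_subproblem:
  assumes "m < 2"
    and "amort (credit n) (keeps rep n VJ j) c1 (7 + tree_time n + credit n)
      (\<lambda>s M. keeps rep n VJ j s M \<and> nmem s VDone 0 = 1)"
    and "amort (credit n) (keeps rep n VJ j) c2 (7 + tree_time n + credit n)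
      (\<lambda>s M. keeps rep n VJ j s M \<and> nmem s VDone 0 = 1)"
  shows "amort (credit n) (keeps rep n VJ j)
    (VDone [\<leftarrow>] NNum 0 ;;
     WHILE finished [=] NNum 0 DO
      (tree_query m ;;
       IF found [=] NNum 0 THEN Abort
       ELSE (IF p1 THEN c1 ELSE (IF p2 THEN c2
       ELSE (IF the_set [=] NNum setA THEN (VP \<leftarrow> eA ;; VQ \<leftarrow> fA ;; remove_bp trees setA kk)
       ELSE (IF the_set [=] NNum setB THEN (VP \<leftarrow> eB ;; VQ \<leftarrow> fB ;; remove_bp trees setB kk)
       ELSE (IF the_set [=] NNum setK THEN (VP \<leftarrow> eK ;; VQ \<leftarrow> fK ;; remove_bp trees setK kk)
       ELSE (VP \<leftarrow> eL ;; VQ \<leftarrow> fL ;; remove_bp trees setL kk))))))))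
    (2 * credit n + 1) (keeps rep n VJ j)" (is "amort _ _ ?c _ _")
proof (rule amortI)
  let ?R = "keeps rep n VJ j" and ?Z = "2 * credit n"
  fix e s b M
  assume s: "?R s M" and b: "e + (?Z + 1) + credit n * card (dom M) \<le> b"
  \<comment> \<open>\<open>?Z\<close> is kept for the last iteration, which removes nothing.\<close>
  define Inv where "Inv t b \<longleftrightarrow>
    avail (credit n) ?R (e + (if nmem t VDone 0 = 0 then ?Z else 1)) t b" for t b
  \<comment> \<open>A removing iteration costs 1 loop test, 5 query steps, at most 6 tests, 2
    updates, 2 argument assignments and \<open>tree_time n\<close>, in total
    \<open>16 + tree_time n\<close>. The last iteration costs 1 + 5 + 3 steps before its branch and
    7 in it besides the insertion, and leaves 1 for the final test; this gives 17, and
    \<open>credit n\<close> funds the new breakpoint.\<close>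
  have pos: "1 < ?Z" "16 + tree_time n \<le> credit n" "17 + tree_time n + credit n \<le> ?Z"
    by (simp_all add: credit_def)
  have InvI: "Inv t b" if "avail (credit n) ?R (e + ?Z) t b" for t b
    using that pos(1) unfolding Inv_def avail_def by (cases "nmem t VDone 0 = 0") auto
  have doneI: "Inv t b" if "avail (credit n) (\<lambda>s M. ?R s M \<and> nmem s VDone 0 = 1) (e + 1) t b"
    for t b
    using that unfolding Inv_def avail_def by auto
  show "runs ?c s b (avail (credit n) ?R e)"
    unfolding runs_Seq[of "NAssign _ _ _"] runs_NAssign
  proof (intro conjI runs_While[where Inv = Inv], goal_cases)
    case 1
    show ?case using b by simp
  next
    case 2
    have "?R (nupd VDone (nval (NNum 0) s) (nval (NNum 0) s) s) M"
      using s by (auto simp: keeps_def intro!: rep_nupd)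
    then show ?case using b by (auto simp: avail_def intro!: InvI exI[of _ M])
  next
    case (3 t b)
    then show ?case using pos(1) by (auto simp: Inv_def avail_def split: if_splits)
  next
    case (4 t b)
    from 4 obtain M where t: "?R t M" and b: "e + ?Z + credit n * card (dom M) \<le> b"
      by (auto simp: Inv_def avail_def)
    have "rep t M" using t by (simp add: keeps_def)
    then have "runs (tree_query m) t (b - 1) (\<lambda>u b'.
      (unchanged_except {Found, ResSet, ResIdx} {Delta} t u \<and> rep u M \<and>
        (if M = Map.empty then nmem u Found 0 = 0
         else nmem u Found 0 = 1 \<and> M (bp_answer u) = Some (rmem u Delta 0) \<and>
           (\<forall>y \<in> ran M. precedes m (rmem u Delta 0) y))) \<and> b - 1 \<le> b' + 5)"
      using assms(1) b pos by (intro runs_tree_query_frame) auto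
    then show ?case
      unfolding runs_Seq[of "tree_query m"]
    proof (rule runs_mono, goal_cases)
      case (1 u b')
      then have u: "?R u M"
        using t by (intro keeps_unchanged[of "{Found, ResSet, ResIdx}"
          "{Delta}" t]) (auto simp: keeps_def)
      have b': "e + ?Z + credit n * card (dom M) \<le> b' + 6" using 1 b by linarith
      show ?case
      proof (cases "M = Map.empty")
        case True
        then show ?thesis using 1 b' pos by simp
      next
        case False
        with 1 have f: "nmem u Found 0 = 1" "M (bp_answer u) = Some (rmem u Delta 0)" by auto
        have "is_breakpoint n (bp_answer u)"
          using rep_bp[of u M] u f(2) by (auto simp: keeps_def)
        then have S: "nmem u ResSet 0 \<in> {setA, setB, setK, setL}"
          by (simp add: is_breakpoint_def bp_answer_def)
        have c1: "runs c1 u b'' Inv" if "b' \<le> b'' + 2" for b''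
          by (rule runs_mono[OF amortD[OF assms(2) u, of "e + 1"]])
            (use that b' pos in \<open>auto intro: doneI\<close>)
        have c2: "runs c2 u b'' Inv" if "b' \<le> b'' + 3" for b''
          by (rule runs_mono[OF amortD[OF assms(3) u, of "e + 1"]])
            (use that b' pos in \<open>auto intro: doneI\<close>)
        have remove: "runs (VP \<leftarrow> x ;; VQ \<leftarrow> y ;; remove_bp trees S kk) u b'' Inv"
          if "nmem u ResSet 0 = S" "b' \<le> b'' + 6" for x y S b''
          by (rule runs_mono[OF runs_remove_answer[OF u f(2) that(1), of "e + ?Z"]])
            (use that(2) b' pos in \<open>auto intro: InvI\<close>)
        have "10 \<le> b'" using b' pos by simp
        show ?thesis
          by (intro runs_CondI c1 c2 remove) (use f(1) S \<open>10 \<le> b'\<close> in auto)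
      qed
    qed
  next
    case (5 t b)
    then show ?case by (auto simp: Inv_def avail_def)
  qed
qed

lemmas amort_intros = amort_Seq amort_Cond amort_Skip
  amort_NAssign[OF stable_rep] amort_RAssign[OF stable_rep] amort_add_bp amort_remove_bp

lemma amort_finish:
  "amort C (keeps rep n VJ j) (VDone [\<leftarrow>] NNum 1) 1
    (\<lambda>s M. keeps rep n VJ j s M \<and> nmem s VDone 0 = 1)"
  by (rule amortI) (auto simp: avail_def keeps_def intro!: rep_nupd)

lemma amort_found:
  assumes "1 \<le> j" "j \<le> n" "S \<in> {setK, setL}" "z \<notin> range RAux" "p \<notin> range RAux" "q \<notin> range RAux"
  shows "amort C (keeps rep n VJ j)
    (RAssign z jj e ;; add_bp trees S jj (RAt z jj) ;; RAssign p jj PP ;; RAssign q jj QQ ;;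
      VDone [\<leftarrow>] NNum 1)
    (7 + tree_time n + C) (\<lambda>s M. keeps rep n VJ j s M \<and> nmem s VDone 0 = 1)"
proof (rule amort_mono)
  show "amort C (keeps rep n VJ j)
    (RAssign z jj e ;; add_bp trees S jj (RAt z jj) ;; RAssign p jj PP ;; RAssign q jj QQ ;;
      VDone [\<leftarrow>] NNum 1)
    (1 + ((3 + tree_time n + C) + (1 + (1 + 1)))) (\<lambda>s M. keeps rep n VJ j s M \<and> nmem s VDone 0 = 1)"
    by (rule amort_Seq amort_RAssign amort_add_bp amort_finish stable_rep |
        (use assms in \<open>auto simp: is_breakpoint_iff setK_def setL_def; fail\<close>))+
qed simp

lemma amort_lower_subproblem:
  assumes "1 \<le> j" "j \<le> n"
  shows "amort (credit n) (keeps rep n VJ j) (lower_subproblem trees)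
    (2 * credit n + 1) (keeps rep n VJ j)"
proof -
  have query: "bp_min trees = tree_query 0" by (simp add: trees_def)
  show ?thesis
    unfolding lower_subproblem_def query
    by (intro amort_subproblem amort_found) (use assms in auto)
qed

lemma amort_upper_subproblem:
  assumes "1 \<le> j" "j \<le> n"
  shows "amort (credit n) (keeps rep n VJ j) (upper_subproblem trees)
    (2 * credit n + 1) (keeps rep n VJ j)"
proof -
  have query: "bp_max trees = tree_query 1" by (simp add: trees_def)
  show ?thesis
    unfolding upper_subproblem_def query
    by (intro amort_subproblem amort_found) (use assms in auto)
qed

text \<open>The cost is left schematic and assembled by the rules over all branches: six insertions,
  four removals, two subproblems and a bounded number of other steps, which 50 credits cover
  generously. The premise \<open>2 \<le> j\<close> makes the index \<open>j - 1\<close> valid in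
  removals.\<close>

lemma amort_solve_subproblems:
  assumes "2 \<le> j" "j \<le> n"
  shows "amort (credit n) (keeps rep n VJ j) (solve_subproblems trees)
    (50 * credit n) (keeps rep n VJ j)"
  apply (rule amort_mono)
   apply (unfold solve_subproblems_def lower_update_def upper_update_def add_alpha_beta_def
      lower_call_def upper_call_def)[1]
   apply (rule amort_intros amort_lower_subproblem amort_upper_subproblem |
      (use assms in \<open>auto simp: is_breakpoint_iff setA_def setB_def setK_def setL_def; fail\<close>))+
  apply (simp add: credit_def)
  done

section \<open>Summing up the phases of the whole program\<close>

lemma amort_tighten_bounds:
  assumes "workspace_stable \<rho>"
  shows "amort C (keeps \<rho> n VN n) tighten_bounds ((n + 1) * 4 + 4) (keeps \<rho> n VN n)"
proof (rule amort_mono)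
  show "amort C (keeps \<rho> n VN n) tighten_bounds
    (1 + (1 + ((n + 1) * (1 + 1 + 2) + 2))) (keeps \<rho> n VN n)"
    unfolding tighten_bounds_def
    by (rule amort_Seq amort_RAssign amort_for_up assms | (auto; fail))+
qed simp

lemma amort_tree_init:
  "amort C (keeps (\<lambda>s M. M = Map.empty) n VN n) (bp_init trees) (32 * n + 35) (keeps rep n VN n)"
proof (rule amortI)
  fix e s b M
  assume s: "keeps (\<lambda>s M. M = Map.empty) n VN n s M" "e + (32 * n + 35) + C * card (dom M) \<le> b"
  then have "runs tree_init s b
    (\<lambda>t b'. (unchanged_except {} {} s t \<and> rep t Map.empty) \<and> b \<le> b' + (32 * nmem s VN 0 + 35))"
    by (intro runs_frame runs_tree_init) (simp add: keeps_def)
  moreover have "bp_init trees = tree_init" by (simp add: trees_def)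
  ultimately show "runs (bp_init trees) s b (avail C (keeps rep n VN n) e)"
  proof (simp, elim runs_mono, goal_cases)
    case (1 t b')
    moreover have n: "nmem s VN 0 = n" "M = Map.empty" using s(1) by (simp_all add: keeps_def)
    ultimately have "keeps rep n VN n t Map.empty"
      by (intro keeps_unchanged[of "{}" "{}" s]) auto
    then show ?case using 1 s(2) n by (auto simp: avail_def intro!: exI[of _ Map.empty])
  qed
qed

lemma amort_initialize:
  assumes "1 \<le> n"
  shows "amort C (keeps (\<lambda>s M. M = Map.empty) n VN n) (initialize trees)
    (32 * n + (n + 1) * 8 + 51 + 2 * tree_time n + 2 * C) (keeps rep n VN n)"
proof (rule amort_mono)
  show "amort C (keeps (\<lambda>s M. M = Map.empty) n VN n) (initialize trees)
    (((n + 1) * (1 + 1 + 2) + 2) + (1 + (1 + (((n + 1) * (1 + 1 + 2) + 2) + ((32 * n + 35) +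
     ((3 + tree_time n + C) + ((3 + tree_time n + C) + (1 + (1 + (1 + 1))))))))))
    (keeps rep n VN n)"
    unfolding initialize_def
    by (rule amort_Seq amort_for_up amort_tree_init amort_add_bp
        amort_RAssign[OF stable_rep] amort_RAssign[OF stable_empty] stable_empty |
        (use assms in \<open>auto simp: is_breakpoint_iff setA_def setB_def; fail\<close>))+
qed simp

lemma amort_recover_solution:
  "amort C (keeps rep n VN n) recover_solution ((n + 1) * 14 + 5) (keeps rep n VN n)"
proof (rule amort_mono)
  show "amort C (keeps rep n VN n) recover_solution
    (1 + (((n + 1) * ((1 + 1 + (1 + 1 + 1)) + 2) + 2) + ((n + 1) * ((1 + 1 +
      (1 + 1 + 1)) + 2) + 2)))
    (keeps rep n VN n)"
    unfolding recover_solution_def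
    by (rule amort_Seq amort_for_up amort_for_down amort_Cond amort_RAssign stable_rep |
      (auto; fail))+
qed simp

lemma runs_alg_seq:
  assumes "qrap_nc_instance n I"
  shows "runs (alg_seq trees) (input_state n I) ((n + 1) * (60 * credit n)) (\<lambda>_ _. True)"
proof -
  define E where "E = (\<lambda>(s :: state) (M :: breakpoints). M = Map.empty)"
  define C where "C = credit n"
  have n: "1 \<le> n" using assms by (simp add: qrap_nc_instance_def)
  have "amort C (keeps E n VN n) (alg_seq trees)
    (((n + 1) * 4 + 4) + ((32 * n + (n + 1) * 8 + 51 + 2 * tree_time n + 2 * C) +
     (((n + 1) * (50 * C + 2) + 2) + ((n + 1) * 14 + 5)))) (keeps rep n VN n)"
    unfolding alg_seq_def E_def C_def
    by (rule amort_Seq amort_tighten_bounds amort_initialize amort_for_up amort_recover_solution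
        amort_solve_subproblems stable_rep stable_empty n | assumption | (auto; fail))+
  moreover have "((n + 1) * 4 + 4) + ((32 * n + (n + 1) * 8 + 51 + 2 * tree_time n + 2 * C) +
     (((n + 1) * (50 * C + 2) + 2) + ((n + 1) * 14 + 5))) \<le> (n + 1) * (60 * C)"
  proof -
    \<comment> \<open>The value 56 is 2 * 13 + 30, as \<open>tree_time n\<close> is at least 13. It
      lets multiples of \<open>(n + 1) * C\<close> absorb all terms that are linear in
      \<open>n\<close>.\<close>
    have C: "2 * tree_time n + 30 \<le> C" "56 \<le> C" by (simp_all add: C_def credit_def tree_time_def)
    define X where "X = (n + 1) * C"
    have "(n + 1) * 56 \<le> X" unfolding X_def using C(2) by (rule mult_le_mono2)
    moreover have "2 * C \<le> X" unfolding X_def using n by (intro mult_le_mono1) simp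
    moreover have "(n + 1) * (60 * C) = 60 * X" "(n + 1) * (50 * C + 2) = 50 * X + 2 * (n + 1)"
      by (simp_all add: X_def algebra_simps)
    ultimately show ?thesis using C(1) by simp
  qed
  ultimately have "amort C (keeps E n VN n) (alg_seq trees) ((n + 1) * (60 * C)) (keeps rep n VN n)"
    by (rule amort_mono)
  \<comment> \<open>Starting from no breakpoints, the initial credit is 0, so the amortized bound is
    an actual one.\<close>
  moreover have "keeps E n VN n (input_state n I) Map.empty"
    by (simp add: keeps_def E_def input_state_def)
  ultimately have "runs (alg_seq trees) (input_state n I) ((n + 1) * (60 * C)) (avail C (keeps rep
    n VN n) 0)"
    by (rule amortD) simp
  then show ?thesis unfolding C_def by (rule runs_mono) simp
qed

lemma time_bound:
  "(\<lambda>n. real ((n + 1) * (60 * credit n))) \<in> O(\<lambda>n. real n * ln (real n))"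
proof -
  \<comment> \<open>From \<open>floorlog\<close> being at most the logarithm plus 1: 2 * (16 + 13) +
    30 = 88.\<close>
  have "real (credit n) \<le> 32 * log 2 (4 * real n + 4) + 88" for n
  proof -
    have "floorlog 2 (4 * n + 4) = nat \<lfloor>log 2 (real (4 * n + 4))\<rfloor> + 1"
      by (simp add: floorlog_def)
    moreover have "0 \<le> log 2 (real (4 * n + 4))" by simp
    ultimately have "real (floorlog 2 (4 * n + 4)) \<le> log 2 (real (4 * n + 4)) + 1"
      by linarith
    then show ?thesis by (simp add: credit_def tree_time_def)
  qed
  then have "real ((n + 1) * (60 * credit n)) \<le>
      (real n + 1) * (60 * (32 * log 2 (4 * real n + 4) + 88))" for n
    unfolding of_nat_mult by (intro mult_mono) auto
  then have "(\<lambda>n. real ((n + 1) * (60 * credit n))) \<in>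
      O(\<lambda>n. (real n + 1) * (60 * (32 * log 2 (4 * real n + 4) + 88)))"
    by (intro landau_o.big_mono always_eventually allI) (simp add: order_trans[OF _ abs_ge_self])
  also have "(\<lambda>n. (real n + 1) * (60 * (32 * log 2 (4 * real n + 4) + 88))) \<in>
      O(\<lambda>n. real n * ln (real n))"
    unfolding log_def by real_asymp
  finally show ?thesis .
qed

theorem lemma6:
  shows "\<exists>D T. implements_breakpoints D \<and> runs_in_time (alg_seq D) T \<and>
           (\<lambda>n. real (T n)) \<in> O(\<lambda>n. real n * ln (real n))"
proof (intro exI conjI)
  show "implements_breakpoints trees"
    unfolding implements_breakpoints_def using represents_trees by blast
  show "runs_in_time (alg_seq trees) (\<lambda>n. (n + 1) * (60 * credit n))"
    unfolding runs_in_time_def using runs_alg_seq by (blast elim: runsE)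
qed (rule time_bound)

end
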